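(* Let $\Omega\subset\mathbb{R}^2$ be a convex open bounded set and let $M>0$. Then $$\inf_{u\in S_{\Omega,M}}F(u)=\phi(\Omega,M),$$ where $$F(u)=\int_\Omega\frac{dx}{1+|\nabla u(x)|^2},\qquad \phi(\Omega,M)=\int_\Omega\frac12\left(1-\frac{M}{\sqrt{M^2+d^2(x)}}\right)dx,\qquad d(x)=\mathrm{dist}(x,\partial\Omega),$$ and $S_{\Omega,M}$ is the class of functions $u:\bar\Omega\to\mathbb{R}$ that satisfy the single impact condition (SIC) and $0\le u(x)\le M$ for all $x\in\bar\Omega$.
   Context: Single impact condition (SIC): let $\Omega\subset\mathbb{R}^2$ be a convex open bounded set. A piecewise smooth function $u:\bar\Omega\to\mathbb{R}$ (not necessarily continuous: jumps are allowed) satisfies SIC if for every regular point $x\in\Omega$ (a point near which $u$ is smooth) and every $t>0$ such that $x-t\nabla u(x)\in\bar\Omega$, $$\frac{u(x-t\nabla u(x))-u(x)}{t}\le\frac12\left(1-|\nabla u(x)|^2\right).$$ *)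

theory Defs
  imports "HOL-Analysis.Analysis"
begin

(* Intended for open S: the derivatives are taken over full neighbourhoods. *)
fun Ck_on :: "nat \<Rightarrow> (real^2) set \<Rightarrow> (real^2 \<Rightarrow> real) \<Rightarrow> bool" where
  "Ck_on 0 S f = continuous_on S f"
| "Ck_on (Suc k) S f =
     (\<exists>g. (\<forall>x\<in>S. GDERIV f x :> g x) \<and> (\<forall>i. Ck_on k S (\<lambda>x. g x $ i)))"

definition smooth_on :: "(real^2) set \<Rightarrow> (real^2 \<Rightarrow> real) \<Rightarrow> bool" where
  "smooth_on S f \<longleftrightarrow> (\<forall>k. Ck_on k S f)"

definition grad :: "(real^2 \<Rightarrow> real) \<Rightarrow> real^2 \<Rightarrow> real^2" where
  "grad u x = (THE D. GDERIV u x :> D)"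

(* Functions on the closure of \<Omega> are represented by total functions on the plane; in all
   definitions below only the values on closure \<Omega> matter. *)

(* The exceptional set is a finite union of piecewise C1 arcs (possibly degenerating to points),
   across which u may jump and near which its gradient may be unbounded. *)
definition piecewise_smooth :: "(real^2) set \<Rightarrow> (real^2 \<Rightarrow> real) \<Rightarrow> bool" where
  "piecewise_smooth \<Omega> u \<longleftrightarrow>
     (\<exists>C. finite C \<and> (\<forall>c\<in>C. valid_path c) \<and> smooth_on (\<Omega> - (\<Union>c\<in>C. path_image c)) u)"

definition regular_point :: "(real^2) set \<Rightarrow> (real^2 \<Rightarrow> real) \<Rightarrow> real^2 \<Rightarrow> bool" where
  "regular_point \<Omega> u x \<longleftrightarrow> (\<exists>U. open U \<and> x \<in> U \<and> U \<subseteq> \<Omega> \<and> smooth_on U u)"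

definition SIC :: "(real^2) set \<Rightarrow> (real^2 \<Rightarrow> real) \<Rightarrow> bool" where
  "SIC \<Omega> u \<longleftrightarrow> piecewise_smooth \<Omega> u \<and>
     (\<forall>x t. regular_point \<Omega> u x \<and> t > 0 \<and> x - t *\<^sub>R grad u x \<in> closure \<Omega> \<longrightarrow>
        (u (x - t *\<^sub>R grad u x) - u x) / t \<le> 1/2 * (1 - (norm (grad u x))\<^sup>2))"

definition admissible :: "(real^2) set \<Rightarrow> real \<Rightarrow> (real^2 \<Rightarrow> real) set" where
  "admissible \<Omega> M = {u. SIC \<Omega> u \<and> (\<forall>x\<in>closure \<Omega>. 0 \<le> u x \<and> u x \<le> M)}"

(* The junk values of grad off the set of regular points enter only on a null set. *)
definition resistance :: "(real^2) set \<Rightarrow> (real^2 \<Rightarrow> real) \<Rightarrow> real" where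
  "resistance \<Omega> u = (LINT x:\<Omega>|lebesgue. 1 / (1 + (norm (grad u x))\<^sup>2))"

definition phi :: "(real^2) set \<Rightarrow> real \<Rightarrow> real" where
  "phi \<Omega> M = (LINT x:\<Omega>|lebesgue.
     1/2 * (1 - M / sqrt (M\<^sup>2 + (infdist x (frontier \<Omega>))\<^sup>2)))"

end

(*
The lower bound: at a regular point x at distance d from the boundary the single impact condition,
applied at the time when the ray x - t grad u(x) has travelled the distance d, gives
|grad u|^2 - 1 <= 2 M |grad u| / d, which is exactly 1 / (1 + |grad u|^2) >= (1 - M / sqrt (M^2 + d^2)) / 2.

The upper bound: take u piecewise affine, with values just below M on small cells and u = 0 elsewhere,
the gradient on a cell pointing away from the nearest boundary point with the extremal slope.  The
ray from a cell must not meet another high cell before it leaves the domain, so it has to run in a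
trench where u = 0, and the trenches must have small total area although the cells fill almost
everything.  This is a Kakeya-Nikodym phenomenon.  Strips with slope sum_k d_k n^-k and offset
- sum_k d_k n^-k tau_k, with digits d_k < n and decreasing heights tau_k, are pairwise disjoint below
height 0, while at a height between two consecutive tau_k they collapse onto few positions; hence
their upper parts have arbitrarily small area compared with their lower parts.  Greedily chosen
horizontal translates of the lower parts cover almost all of a thin slab.  Cells of one slab may
overlap in direction: u falls along a ray at least twice as steeply as the reflected particle does,
so a ray never hits a cell of its own slab.
*)
theory Submission
  imports Defs
begin

section \<open>A digit construction of Kakeya strips\<close>

text \<open>What makes the bound sharp is that only progress in one fixed direction counts. For
  convex \<open>\<Omega>\<close> a supporting line at the nearest boundary point bounds the
  remaining run of every ray of a small box, so a cell can have the extremal slope for that run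
  although its own ray is slightly tilted; a tilt of at most \<open>\<rho>\<close> raises the
  resistance density by at most the square of \<open>\<rho>\<close>. The obstacle is that the
  trenches of one slab cut through the cells of all other slabs and boxes. Hence the order of
  choices: the error \<open>\<delta>\<close> fixes the boxes and a bound for the slopes, these fix
  the slab thickness \<open>h\<close> and thereby the number of regions, and only then is the
  admissible trench area \<open>\<eta>\<close> per region chosen. Inside one slab the same
  circularity appears, because thinner strips need more translates in the greedy cover. It is
  resolved by measuring the trench area relative to the total width of a family of strips: the sum
  of these widths over all translates has a bound known before the strips are chosen.\<close>

text \<open>The digits of an index in base n, least significant last, determine a strip: \<open>digit_pos\<close> is the
  position at height t of the line with slope \<open>digit_slope\<close>, and the k-th digit has no influence on
  the position at height \<open>\<tau> k\<close>.  Prefixes of the digit string are quotients of the index by powers of n.\<close>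

fun digit_slope :: "nat \<Rightarrow> nat \<Rightarrow> nat \<Rightarrow> real" where
  "digit_slope n 0 i = 0"
| "digit_slope n (Suc k) i = digit_slope n k (i div n) + real (i mod n) / real n ^ Suc k"

fun digit_pos :: "nat \<Rightarrow> (nat \<Rightarrow> real) \<Rightarrow> nat \<Rightarrow> nat \<Rightarrow> real \<Rightarrow> real" where
  "digit_pos n \<tau> 0 i t = 0"
| "digit_pos n \<tau> (Suc k) i t =
     digit_pos n \<tau> k (i div n) t + real (i mod n) / real n ^ Suc k * (t - \<tau> (Suc k))"

lemma digit_pos_affine: "digit_pos n \<tau> k i t = digit_pos n \<tau> k i 0 + digit_slope n k i * t"
proof (induction k arbitrary: i)
  case (Suc k)
  show ?case
    using Suc[of "i div n"] by (simp add: algebra_simps diff_divide_distrib)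
qed simp

text \<open>The largest digit contributes (n - 1) / n^(k+1); it is written as a difference so that
  sums over consecutive digits telescope.\<close>

lemma mod_over_power_le:
  assumes "n > 0"
  shows "real (i mod n) / real n ^ Suc k \<le> 1 / real n ^ k - 1 / real n ^ Suc k"
proof -
  have "real (i mod n) \<le> real n - 1"
    using assms by (metis Suc_leI mod_less_divisor of_nat_1 of_nat_diff of_nat_mono One_nat_def Suc_pred le_simps(2))
  then have "real (i mod n) / real n ^ Suc k \<le> (real n - 1) / real n ^ Suc k"
    by (simp add: divide_right_mono)
  also have "\<dots> = 1 / real n ^ k - 1 / real n ^ Suc k"
    using assms by (simp add: field_simps)
  finally show ?thesis .
qed

lemma digit_slope_bounds:
  assumes "n > 0"
  shows "0 \<le> digit_slope n k i \<and> digit_slope n k i \<le> 1 - 1 / real n ^ k"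
proof (induction k arbitrary: i)
  case (Suc k)
  show ?case
    using Suc[of "i div n"] mod_over_power_le[OF assms, of i k] by (simp del: power_Suc)
qed simp

text \<open>Below the pivots the positions are ordered like digit expansions: the last digit moves a
  line by at most n - 1 steps of size q, while lines with different prefixes are at least n such
  steps apart.\<close>

lemma digit_pos_separated:
  assumes n: "n > 0" and dec: "\<And>k. \<tau> (Suc k) \<le> \<tau> k" and t: "t \<le> \<tau> k"
    and ij: "i < n ^ k" "j < n ^ k" "i \<noteq> j"
  shows "(\<tau> k - t) / real n ^ k \<le> \<bar>digit_pos n \<tau> k i t - digit_pos n \<tau> k j t\<bar>"
  using t ij
proof (induction k arbitrary: i j)
  case (Suc k)
  define q where "q = (\<tau> (Suc k) - t) / real n ^ Suc k"
  have q0: "0 \<le> q" using Suc.prems n by (simp add: q_def)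
  have step: "digit_pos n \<tau> (Suc k) l t = digit_pos n \<tau> k (l div n) t - real (l mod n) * q" for l
    by (simp add: q_def algebra_simps diff_divide_distrib del: power_Suc)
  show ?case
  proof (cases "i div n = j div n")
    case True
    then have ne: "i mod n \<noteq> j mod n" using Suc.prems by (metis div_mult_mod_eq)
    have "digit_pos n \<tau> (Suc k) i t - digit_pos n \<tau> (Suc k) j t = (real (j mod n) - real (i mod n)) * q"
      unfolding step True by (simp add: algebra_simps)
    moreover have "1 \<le> \<bar>real (j mod n) - real (i mod n)\<bar>"
      using ne by linarith
    ultimately show ?thesis
      using q0 mult_right_mono[of 1 "\<bar>real (j mod n) - real (i mod n)\<bar>" q]
      by (simp add: abs_mult q_def[symmetric] del: digit_pos.simps power_Suc)
  next
    case False
    have lt: "i div n < n ^ k" "j div n < n ^ k"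
      using Suc.prems by (auto simp: less_mult_imp_div_less mult.commute)
    have IH: "(\<tau> k - t) / real n ^ k \<le> \<bar>digit_pos n \<tau> k (i div n) t - digit_pos n \<tau> k (j div n) t\<bar>"
      using Suc.IH[OF _ lt False] Suc.prems dec[of k] by linarith
    \<comment> \<open>Here the pivots have to be decreasing: the pivot of the prefix is the higher
      one, so n steps of the last digit fit between two different prefixes.\<close>
    have "real n * q = (\<tau> (Suc k) - t) / real n ^ k"
      using n by (simp add: q_def)
    also have "\<dots> \<le> (\<tau> k - t) / real n ^ k"
      using dec[of k] by (simp add: divide_right_mono)
    finally have 1: "real n * q \<le> (\<tau> k - t) / real n ^ k" .
    have "\<bar>real (i mod n) - real (j mod n)\<bar> \<le> real n - 1"
      using mod_less_divisor[OF n, of i] mod_less_divisor[OF n, of j] by linarith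
    then have "\<bar>(real (i mod n) - real (j mod n)) * q\<bar> \<le> (real n - 1) * q"
      using q0 by (simp add: abs_mult mult_right_mono)
    then show ?thesis
      using 1 IH unfolding step q_def[symmetric] by (simp add: algebra_simps)
  qed
qed simp

text \<open>The omitted digits form a geometric tail: the j-th one moves the line by at most
  \<Lambda> (n - 1) / n^j.\<close>

lemma digit_pos_prefix_close:
  assumes n: "n > 0" and km: "k \<le> m" and bd: "\<And>j. j \<le> m \<Longrightarrow> \<bar>t - \<tau> j\<bar> \<le> \<Lambda>"
  shows "\<bar>digit_pos n \<tau> m i t - digit_pos n \<tau> k (i div n ^ (m - k)) t\<bar> \<le> \<Lambda> * (1 / real n ^ k - 1 / real n ^ m)"
  using km bd
proof (induction m arbitrary: i rule: dec_induct)
  case (step m)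
  have eq: "i div n div n ^ (m - k) = i div n ^ (Suc m - k)"
    using step by (simp add: Suc_diff_le div_mult2_eq)
  have IH: "\<bar>digit_pos n \<tau> m (i div n) t - digit_pos n \<tau> k (i div n ^ (Suc m - k)) t\<bar>
      \<le> \<Lambda> * (1 / real n ^ k - 1 / real n ^ m)"
    using step.IH[of "i div n"] step.prems unfolding eq by simp
  have "\<bar>real (i mod n) / real n ^ Suc m * (t - \<tau> (Suc m))\<bar>
      = real (i mod n) / real n ^ Suc m * \<bar>t - \<tau> (Suc m)\<bar>"
    by (simp add: abs_mult)
  also have "\<dots> \<le> (1 / real n ^ m - 1 / real n ^ Suc m) * \<Lambda>"
    by (intro mult_mono mod_over_power_le[OF n] step.prems)
       (use n in \<open>auto simp: field_simps\<close>)
  finally have "\<bar>real (i mod n) / real n ^ Suc m * (t - \<tau> (Suc m))\<bar>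
      \<le> (1 / real n ^ m - 1 / real n ^ Suc m) * \<Lambda>" .
  then show ?case
    using IH unfolding digit_pos.simps
    by (simp add: algebra_simps abs_le_iff diff_divide_distrib del: power_Suc)
qed simp

text \<open>Close to \<open>\<tau> (Suc k)\<close> the digit k + 1 is multiplied by a factor of at
  most \<Lambda> / n and so weighs no more than the bound for all later digits together. All lines
  with a common prefix of length k therefore bunch within \<Lambda> / n^(k+1) up to a factor 2,
  whereas the prefix alone would only give the order \<Lambda> / n^k.\<close>

lemma digit_pos_layer_close:
  assumes n: "n > 0" and km: "k < m" and bd: "\<And>j. j \<le> m \<Longrightarrow> \<bar>t - \<tau> j\<bar> \<le> \<Lambda>"
    and near: "\<bar>t - \<tau> (Suc k)\<bar> \<le> \<Lambda> / real n"
  shows "\<bar>digit_pos n \<tau> m i t - digit_pos n \<tau> k (i div n ^ (m - k)) t\<bar> \<le> 2 * \<Lambda> / real n ^ Suc k"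
proof -
  define i' where "i' = i div n ^ (m - Suc k)"
  have L: "0 \<le> \<Lambda>" using bd[of 0] by linarith
  have 1: "\<bar>digit_pos n \<tau> m i t - digit_pos n \<tau> (Suc k) i' t\<bar> \<le> \<Lambda> / real n ^ Suc k"
  proof -
    have "\<bar>digit_pos n \<tau> m i t - digit_pos n \<tau> (Suc k) i' t\<bar> \<le> \<Lambda> * (1 / real n ^ Suc k - 1 / real n ^ m)"
      unfolding i'_def by (rule digit_pos_prefix_close) (use assms in auto)
    also have "\<dots> \<le> \<Lambda> * (1 / real n ^ Suc k)"
      using L by (intro mult_left_mono) auto
    finally show ?thesis by simp
  qed
  have "i' div n = i div n ^ (m - k)"
    using km unfolding i'_def
    by (metis Suc_diff_Suc div_mult2_eq mult.commute power_Suc)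
  then have 2: "digit_pos n \<tau> (Suc k) i' t - digit_pos n \<tau> k (i div n ^ (m - k)) t
      = real (i' mod n) / real n ^ Suc k * (t - \<tau> (Suc k))"
    by simp
  have "\<bar>real (i' mod n) / real n ^ Suc k * (t - \<tau> (Suc k))\<bar>
      = real (i' mod n) / real n ^ Suc k * \<bar>t - \<tau> (Suc k)\<bar>"
    by (simp add: abs_mult)
  also have "\<dots> \<le> real n / real n ^ Suc k * (\<Lambda> / real n)"
    using n near L mod_less_divisor[OF n, of i']
    by (intro mult_mono divide_right_mono) (auto simp del: mod_less_divisor)
  also have "\<dots> = \<Lambda> / real n ^ Suc k" using n by simp
  finally have "\<bar>digit_pos n \<tau> (Suc k) i' t - digit_pos n \<tau> k (i div n ^ (m - k)) t\<bar> \<le> \<Lambda> / real n ^ Suc k"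
    unfolding 2 .
  then have "\<bar>digit_pos n \<tau> m i t - digit_pos n \<tau> k (i div n ^ (m - k)) t\<bar>
      \<le> \<Lambda> / real n ^ Suc k + \<Lambda> / real n ^ Suc k"
    using 1 by linarith
  then show ?thesis by simp
qed

section \<open>Orthonormal frames in the plane and areas of sheared rectangles\<close>

definition orthonormal2 :: "real^2 \<Rightarrow> real^2 \<Rightarrow> bool" where
  "orthonormal2 e f \<longleftrightarrow> norm e = 1 \<and> norm f = 1 \<and> e \<bullet> f = 0"

lemma orthonormal2_inner:
  assumes "orthonormal2 e f"
  shows "e \<bullet> e = 1" "f \<bullet> f = 1" "e \<bullet> f = 0" "f \<bullet> e = 0"
  using assms by (auto simp: orthonormal2_def dot_square_norm inner_commute)

lemma orthonormal2_expand:
  assumes "orthonormal2 e f"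
  shows "x = (x \<bullet> f) *\<^sub>R f + (x \<bullet> e) *\<^sub>R e"
proof -
  have e: "e$1*e$1 + e$2*e$2 = 1" and f: "f$1*f$1 + f$2*f$2 = 1" and ef: "e$1*f$1 + e$2*f$2 = 0"
    using orthonormal2_inner[OF assms] by (auto simp: inner_vec_def sum_2)
  \<comment> \<open>The determinant of the frame. With d * d = 1 the formulas for the components of
    f say that f is e turned by a right angle, in one of the two senses.\<close>
  define d where "d = e$1*f$2 - e$2*f$1"
  have d2: "d * d = 1" using e f ef unfolding d_def by algebra
  have f1: "f$1 = - d * e$2" using e f ef unfolding d_def by algebra
  have f2: "f$2 = d * e$1" using e f ef unfolding d_def by algebra
  have "x$1 = (x$1*f$1 + x$2*f$2) * f$1 + (x$1*e$1 + x$2*e$2)*e$1"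
    unfolding f1 f2 using d2 e by algebra
  moreover have "x$2 = (x$1*f$1 + x$2*f$2) * f$2 + (x$1*e$1 + x$2*e$2)*e$2"
    unfolding f1 f2 using d2 e by algebra
  ultimately show ?thesis
    by (simp add: vec_eq_iff forall_2 inner_vec_def sum_2)
qed

lemma orthonormal2_ex:
  fixes e :: "real^2"
  assumes "norm e = 1"
  obtains f where "orthonormal2 e f"
proof
  show "orthonormal2 e (vector [- e$2, e$1])"
    using assms by (simp add: orthonormal2_def norm_eq_sqrt_inner inner_vec_def sum_2 add.commute)
qed

definition parallelogram :: "real^2 \<Rightarrow> real^2 \<Rightarrow> real \<Rightarrow> real \<Rightarrow> real \<Rightarrow> real \<Rightarrow> real \<Rightarrow> (real^2) set" where
  "parallelogram e f a c W t1 t2 =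
     {x. c \<le> x \<bullet> f - a * (x \<bullet> e) \<and> x \<bullet> f - a * (x \<bullet> e) \<le> c + W \<and> t1 \<le> x \<bullet> e \<and> x \<bullet> e \<le> t2}"

text \<open>In the coordinates \<open>x \<bullet> f - a * (x \<bullet> e)\<close> and
  \<open>x \<bullet> e\<close> the set is a rectangle, and the change of coordinates is a shear
  followed by an isometry, so its determinant is 1 or -1.\<close>

lemma measure_parallelogram:
  assumes ef: "orthonormal2 e f" and W: "0 \<le> W" and t: "t1 \<le> t2"
  shows "parallelogram e f a c W t1 t2 \<in> lmeasurable" (is ?A)
    and "measure lebesgue (parallelogram e f a c W t1 t2) = W * (t2 - t1)" (is ?B)
proof -
  note ip = orthonormal2_inner[OF ef]
  define g :: "real^2 \<Rightarrow> real^2" where "g y = (y$1 + a * y$2) *\<^sub>R f + (y$2) *\<^sub>R e" for y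
  have lin: "linear g"
    by (rule linearI) (simp_all add: g_def algebra_simps)
  have eq: "parallelogram e f a c W t1 t2 = g ` cbox (vector [c, t1]) (vector [c + W, t2])"
  proof (intro set_eqI iffI)
    fix x assume x: "x \<in> parallelogram e f a c W t1 t2"
    define y :: "real^2" where "y = vector [x \<bullet> f - a * (x \<bullet> e), x \<bullet> e]"
    have "g y = x"
      using orthonormal2_expand[OF ef, of x] by (simp add: g_def y_def)
    moreover have "y \<in> cbox (vector [c, t1]) (vector [c + W, t2])"
      using x by (simp add: mem_box_cart forall_2 y_def parallelogram_def)
    ultimately show "x \<in> g ` cbox (vector [c, t1]) (vector [c + W, t2])" by blast
  next
    fix x assume "x \<in> g ` cbox (vector [c, t1]) (vector [c + W, t2])"
    then obtain y where y: "x = g y" "c \<le> y$1" "y$1 \<le> c + W" "t1 \<le> y$2" "y$2 \<le> t2"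
      by (auto simp: mem_box_cart forall_2)
    have "x \<bullet> f = y$1 + a * y$2" "x \<bullet> e = y$2"
      using y ip by (simp_all add: g_def inner_add_left)
    then show "x \<in> parallelogram e f a c W t1 t2"
      using y by (simp add: parallelogram_def)
  qed
  have e: "e$1*e$1 + e$2*e$2 = 1" and f: "f$1*f$1 + f$2*f$2 = 1" and ef': "e$1*f$1 + e$2*f$2 = 0"
    using ip by (auto simp: inner_vec_def sum_2)
  have "det (matrix g) = f$1 * (a * f$2 + e$2) - (a * f$1 + e$1) * f$2"
    by (simp add: det_2 matrix_def g_def axis_def)
  also have "\<dots> = f$1*e$2 - e$1*f$2" by (simp add: algebra_simps)
  finally have det: "det (matrix g) = f$1*e$2 - e$1*f$2" .
  have "(f$1*e$2 - e$1*f$2)^2 = 1" using e f ef' by algebra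
  then have absdet: "\<bar>det (matrix g)\<bar> = 1" unfolding det by (simp add: abs_square_eq_1)
  show ?A unfolding eq by (rule measurable_linear_image_interval[OF lin])
  have "cbox (vector [c, t1]) (vector [c + W, t2]) \<noteq> ({} :: (real^2) set)"
    using W t by (auto simp: interval_ne_empty_cart forall_2)
  then show ?B
    unfolding eq measure_linear_image[OF lin lmeasurable_cbox] absdet
    by (simp add: content_cbox_cart UNIV_2)
qed

lemma measure_finite_UN_le_card:
  assumes "finite I" and "\<And>i. i \<in> I \<Longrightarrow> A i \<in> lmeasurable"
    and "\<And>i. i \<in> I \<Longrightarrow> measure lebesgue (A i) \<le> b"
  shows "(\<Union>i\<in>I. A i) \<in> lmeasurable" "measure lebesgue (\<Union>i\<in>I. A i) \<le> real (card I) * b"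
proof -
  show "(\<Union>i\<in>I. A i) \<in> lmeasurable"
    using assms by (intro fmeasurable.finite_UN) auto
  have "measure lebesgue (\<Union>i\<in>I. A i) \<le> (\<Sum>i\<in>I. measure lebesgue (A i))"
    using assms by (intro measure_UNION_le) (auto simp: fmeasurableD)
  also have "\<dots> \<le> real (card I) * b"
    using sum_bounded_above[of I "\<lambda>i. measure lebesgue (A i)" b] assms by simp
  finally show "measure lebesgue (\<Union>i\<in>I. A i) \<le> real (card I) * b" .
qed

text \<open>Height is measured by \<open>x \<bullet> e\<close>. The strips do not overlap up to
  height 0, and their continuation from height 0 to \<Lambda> is the trench. Its area is compared
  with the total width \<open>real N * w\<close> because the number of translates needed later is
  inversely proportional to that width. \<open>\<beta>\<close> and \<open>v\<close> only move the
  picture.\<close>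

lemma kakeya_strips:
  assumes ef: "orthonormal2 e f" and \<Lambda>: "0 < \<Lambda>" and \<kappa>: "0 < \<kappa>" and \<rho>: "0 < \<rho>" "\<rho> \<le> 1"
  obtains N :: nat and w :: real and a c :: "nat \<Rightarrow> real"
  where "0 < N" "0 < w" "real N * w \<le> 1"
    "\<And>i. 0 \<le> a i \<and> a i \<le> \<rho>"
    "\<And>i. \<bar>c i\<bar> \<le> \<Lambda>"
    "\<And>i j t. i < N \<Longrightarrow> j < N \<Longrightarrow> i \<noteq> j \<Longrightarrow> t \<le> 0 \<Longrightarrow> w \<le> \<bar>(c i + a i * t) - (c j + a j * t)\<bar>"
    "\<And>\<beta> v. \<exists>T. T \<in> lmeasurable \<and> measure lebesgue T \<le> \<kappa> * (real N * w) \<and>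
       {x. \<beta> \<le> x \<bullet> e \<and> x \<bullet> e \<le> \<beta> + \<Lambda> \<and>
         (\<exists>i<N. c i + v + a i * (x \<bullet> e - \<beta>) \<le> x \<bullet> f \<and> x \<bullet> f \<le> c i + v + a i * (x \<bullet> e - \<beta>) + w)} \<subseteq> T"
proof -
  \<comment> \<open>The lowest pivot sits at height s, and the total width of the strips will be
    \<rho> * s. Below height s the strips are counted in full, with area \<rho> * s * s, and s \<le>
    \<kappa> / 2 makes this at most half of the allowed trench area. The other half is left for the
    layers above.\<close>
  define s where "s = min (\<kappa> / 2) (min \<Lambda> 1)"
  have s: "0 < s" "s \<le> \<kappa> / 2" "s \<le> \<Lambda>" "s \<le> 1" using \<Lambda> \<kappa> by (auto simp: s_def)
  \<comment> \<open>The layers above height s have total area at most 5 \<rho> \<Lambda>^2 / n,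
    which this choice puts below \<rho> \<kappa> s / 2.\<close>
  obtain n :: nat where "n \<noteq> 0" "10 * \<Lambda>\<^sup>2 / (\<kappa> * s) < real n"
    using reals_Archimedean2 [of "max 1 (10 * \<Lambda>\<^sup>2 / (\<kappa> * s))"]
    by (metis max_less_iff_conj of_nat_0 not_one_less_zero)
  then have n: "n > 0" "5 * \<Lambda>\<^sup>2 / n \<le> \<kappa> * s / 2"
    using \<kappa> s by (auto simp: field_simps)
  \<comment> \<open>Pivots descend in n equal steps from \<Lambda> to s. Every layer between
    consecutive pivots is at most \<Lambda> / n thick, so the pivoting digit stays harmless
    throughout its layer.\<close>
  define \<tau> where "\<tau> k = s + (\<Lambda> - s) * (real n - real k) / real n" for k
  have dec: "\<tau> (Suc k) \<le> \<tau> k" for k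
    using s n by (auto simp: \<tau>_def divide_right_mono mult_left_mono)
  have \<tau>n: "\<tau> n = s" and \<tau>0: "\<tau> 0 = \<Lambda>"
    using n by (auto simp: \<tau>_def)
  have \<tau>step: "\<tau> k - \<tau> (Suc k) = (\<Lambda> - s) / n" for k
    using n by (simp add: \<tau>_def field_simps)
  have anti: "j \<le> k \<Longrightarrow> \<tau> k \<le> \<tau> j" for j k
    using lift_Suc_antimono_le[of \<tau>, OF dec] by blast
  have \<tau>rng: "0 \<le> \<tau> k \<and> \<tau> k \<le> \<Lambda>" if "k \<le> n" for k
    using anti[of k n] anti[of 0 k] \<tau>n \<tau>0 s that by auto
  \<comment> \<open>As wide as the separation permits: at height at most 0 all pivots are at least s
    above, so the scaled lines are at least \<rho> s / n^n apart.\<close>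
  define w where "w = \<rho> * s / real n ^ n"
  define a where "a i = \<rho> * digit_slope n n i" for i
  define c where "c i = \<rho> * digit_pos n \<tau> n i 0" for i
  have pos: "c i + a i * t = \<rho> * digit_pos n \<tau> n i t" for i t
    using digit_pos_affine[of n \<tau> n i t] by (simp add: a_def c_def algebra_simps)
  have Nw: "real (n ^ n) * w = \<rho> * s" using n by (simp add: w_def)
  have abound: "0 \<le> a i \<and> a i \<le> \<rho>" for i
  proof -
    have "0 \<le> digit_slope n n i" "digit_slope n n i \<le> 1"
      using digit_slope_bounds[of n n i] n by (auto intro: order_trans)
    then show ?thesis using \<rho> by (auto simp: a_def mult_left_le)
  qed
  show thesis
  proof (rule that[of "n ^ n" w a c])
    show "0 < n ^ n" "0 < w" using n \<rho> s by (auto simp: w_def)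
    show "real (n ^ n) * w \<le> 1"
      unfolding Nw using \<rho> s by (intro mult_le_one) auto
    show "0 \<le> a i \<and> a i \<le> \<rho>" for i by (rule abound)
    show "\<bar>c i\<bar> \<le> \<Lambda>" for i
    proof -
      have "\<bar>digit_pos n \<tau> n i 0 - digit_pos n \<tau> 0 (i div n ^ (n - 0)) 0\<bar> \<le> \<Lambda> * (1 / real n ^ 0 - 1 / real n ^ n)"
        by (rule digit_pos_prefix_close) (use n \<tau>rng in auto)
      also have "\<dots> \<le> \<Lambda> * 1"
        using \<Lambda> by (intro mult_left_mono) auto
      finally have "\<bar>digit_pos n \<tau> n i 0\<bar> \<le> \<Lambda>" by simp
      then have "\<rho> * \<bar>digit_pos n \<tau> n i 0\<bar> \<le> 1 * \<Lambda>"
        using \<rho> by (intro mult_mono) auto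
      then show ?thesis using \<rho> by (simp add: c_def abs_mult)
    qed
    show "w \<le> \<bar>(c i + a i * t) - (c j + a j * t)\<bar>"
      if "i < n ^ n" "j < n ^ n" "i \<noteq> j" "t \<le> 0" for i j t
    proof -
      have "s / real n ^ n \<le> (\<tau> n - t) / real n ^ n"
        using that by (simp add: \<tau>n divide_right_mono)
      also have "\<dots> \<le> \<bar>digit_pos n \<tau> n i t - digit_pos n \<tau> n j t\<bar>"
        by (rule digit_pos_separated) (use n dec that s \<tau>n in auto)
      finally have "\<rho> * (s / real n ^ n) \<le> \<rho> * \<bar>digit_pos n \<tau> n i t - digit_pos n \<tau> n j t\<bar>"
        using \<rho> by (intro mult_left_mono) auto
      also have "\<dots> = \<bar>\<rho> * (digit_pos n \<tau> n i t - digit_pos n \<tau> n j t)\<bar>"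
        using \<rho> by (simp add: abs_mult)
      finally show ?thesis
        unfolding pos by (simp add: w_def right_diff_distrib)
    qed
    fix \<beta> v
    define near where "near = (\<Union>i\<in>{..<n ^ n}. parallelogram e f (a i) (c i + v - a i * \<beta>) w \<beta> (\<beta> + s))"
    \<comment> \<open>The factor 5 is 2 + 2 + 1: a line may deviate from the line of its prefix by 2
      \<rho> \<Lambda> / n^(k+1) to either side, and the strip width w is at most \<rho> \<Lambda> /
      n^(k+1).\<close>
    define P where "P k i = parallelogram e f (\<rho> * digit_slope n k i)
        (\<rho> * digit_pos n \<tau> k i 0 + v - \<rho> * digit_slope n k i * \<beta> - 2 * \<rho> * \<Lambda> / real n ^ Suc k)
        (5 * \<rho> * \<Lambda> / real n ^ Suc k) (\<beta> + \<tau> (Suc k)) (\<beta> + \<tau> k)" for k i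
    define far where "far = (\<Union>k\<in>{..<n}. \<Union>i\<in>{..<n ^ k}. P k i)"
    have near: "near \<in> lmeasurable" "measure lebesgue near \<le> real (n ^ n) * (w * s)"
      using measure_finite_UN_le_card[of "{..<n ^ n}"
          "\<lambda>i. parallelogram e f (a i) (c i + v - a i * \<beta>) w \<beta> (\<beta> + s)" "w * s"]
        measure_parallelogram[OF ef, of w \<beta> "\<beta> + s"] \<open>0 < w\<close> s
      unfolding near_def by auto
    have P: "P k i \<in> lmeasurable" "measure lebesgue (P k i) \<le> 5 * \<rho> * \<Lambda>\<^sup>2 / (n * real n ^ Suc k)" for k i
    proof -
      have W: "0 \<le> 5 * \<rho> * \<Lambda> / real n ^ Suc k" using \<rho> \<Lambda> by simp
      have T: "\<beta> + \<tau> (Suc k) \<le> \<beta> + \<tau> k" using dec by simp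
      show "P k i \<in> lmeasurable"
        unfolding P_def by (rule measure_parallelogram[OF ef W T])
      have "measure lebesgue (P k i) = 5 * \<rho> * \<Lambda> / real n ^ Suc k * ((\<Lambda> - s) / n)"
        unfolding P_def measure_parallelogram(2)[OF ef W T] using \<tau>step[of k] by simp
      also have "\<dots> \<le> 5 * \<rho> * \<Lambda> / real n ^ Suc k * (\<Lambda> / n)"
        using W s by (intro mult_left_mono divide_right_mono) auto
      finally show "measure lebesgue (P k i) \<le> 5 * \<rho> * \<Lambda>\<^sup>2 / (n * real n ^ Suc k)"
        by (simp add: power2_eq_square mult_ac)
    qed
    \<comment> \<open>Layer k needs n^k parallelograms of width of order n^-(k+1) and height of
      order 1 / n. So every layer has area of order n^-2, independently of k, and n layers have area
      of order 1 / n.\<close>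
    have layer: "(\<Union>i\<in>{..<n ^ k}. P k i) \<in> lmeasurable"
      "measure lebesgue (\<Union>i\<in>{..<n ^ k}. P k i) \<le> 5 * \<rho> * \<Lambda>\<^sup>2 / (n * n)" for k
    proof -
      note * = measure_finite_UN_le_card[of "{..<n ^ k}" "P k" "5 * \<rho> * \<Lambda>\<^sup>2 / (n * real n ^ Suc k)", OF _ P]
      show "(\<Union>i\<in>{..<n ^ k}. P k i) \<in> lmeasurable" using * by simp
      show "measure lebesgue (\<Union>i\<in>{..<n ^ k}. P k i) \<le> 5 * \<rho> * \<Lambda>\<^sup>2 / (n * n)"
        using *(2) n by (simp add: field_simps)
    qed
    have far: "far \<in> lmeasurable" "measure lebesgue far \<le> real n * (5 * \<rho> * \<Lambda>\<^sup>2 / (n * n))"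
      using measure_finite_UN_le_card[of "{..<n}" "\<lambda>k. \<Union>i\<in>{..<n ^ k}. P k i", OF _ layer]
      unfolding far_def by auto
    have "measure lebesgue (near \<union> far) \<le> measure lebesgue near + measure lebesgue far"
      using near far by (intro measure_Un_le) (auto simp: fmeasurableD)
    also have "\<dots> \<le> \<rho> * s * s + \<rho> * (5 * \<Lambda>\<^sup>2 / n)"
    proof (rule add_mono)
      show "measure lebesgue near \<le> \<rho> * s * s" using near(2) Nw by (metis mult.assoc)
      show "measure lebesgue far \<le> \<rho> * (5 * \<Lambda>\<^sup>2 / n)" using far(2) n by (simp add: field_simps)
    qed
    also have "\<dots> \<le> \<rho> * s * (\<kappa> / 2) + \<rho> * (\<kappa> * s / 2)"
      using \<rho> s n(2) by (intro add_mono mult_left_mono) auto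
    also have "\<dots> = \<kappa> * (real (n ^ n) * w)" unfolding Nw by simp
    finally have meas: "measure lebesgue (near \<union> far) \<le> \<kappa> * (real (n ^ n) * w)" .
    have sub: "x \<in> near \<union> far"
      if x: "\<beta> \<le> x \<bullet> e" "x \<bullet> e \<le> \<beta> + \<Lambda>" and i: "i < n ^ n"
        and lo: "c i + v + a i * (x \<bullet> e - \<beta>) \<le> x \<bullet> f"
        and hi: "x \<bullet> f \<le> c i + v + a i * (x \<bullet> e - \<beta>) + w" for x i
    proof (cases "x \<bullet> e - \<beta> \<le> s")
      case True
      then have "x \<in> parallelogram e f (a i) (c i + v - a i * \<beta>) w \<beta> (\<beta> + s)"
        using x lo hi by (simp add: parallelogram_def algebra_simps)
      then show ?thesis using i by (auto simp: near_def)
    next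
      case False
      define t where "t = x \<bullet> e - \<beta>"
      have t: "s \<le> t" "t \<le> \<Lambda>" using False x by (auto simp: t_def)
      define k where "k = (LEAST k. \<tau> (Suc k) \<le> t)"
      have "\<tau> (Suc (n - 1)) \<le> t" using n t \<tau>n by simp
      then have k: "\<tau> (Suc k) \<le> t" "k \<le> n - 1"
        unfolding k_def by (auto intro: LeastI Least_le)
      have k2: "t \<le> \<tau> k"
      proof (cases k)
        case 0 then show ?thesis using t \<tau>0 by simp
      next
        case (Suc k')
        then show ?thesis
          using not_less_Least[of k' "\<lambda>k. \<tau> (Suc k) \<le> t"] by (simp add: k_def)
      qed
      have kn: "k < n" using k n by simp
      define i' where "i' = i div n ^ (n - k)"
      have i': "i' < n ^ k"
        using i kn unfolding i'_def
        by (metis le_add_diff_inverse less_imp_le less_mult_imp_div_less power_add)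
      have "\<bar>digit_pos n \<tau> n i t - digit_pos n \<tau> k i' t\<bar> \<le> 2 * \<Lambda> / real n ^ Suc k"
        unfolding i'_def
      proof (rule digit_pos_layer_close[OF n(1) kn])
        show "\<bar>t - \<tau> j\<bar> \<le> \<Lambda>" if "j \<le> n" for j
          using \<tau>rng[OF that] t s by linarith
        have "(\<Lambda> - s) / n \<le> \<Lambda> / n" using s by (simp add: divide_right_mono)
        then show "\<bar>t - \<tau> (Suc k)\<bar> \<le> \<Lambda> / real n"
          using k k2 \<tau>step[of k] by linarith
      qed
      then have "\<rho> * \<bar>digit_pos n \<tau> n i t - digit_pos n \<tau> k i' t\<bar> \<le> \<rho> * (2 * \<Lambda> / real n ^ Suc k)"
        using \<rho> by (intro mult_left_mono) auto
      then have close: "\<bar>\<rho> * digit_pos n \<tau> n i t - \<rho> * digit_pos n \<tau> k i' t\<bar> \<le> 2 * \<rho> * \<Lambda> / real n ^ Suc k"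
        using \<rho> by (simp add: abs_mult[symmetric] right_diff_distrib[symmetric] mult_ac
            abs_mult_pos'[symmetric] del: power_Suc)
      have "real n ^ Suc k \<le> real n ^ n" using n kn by (intro power_increasing) auto
      then have "w \<le> \<rho> * \<Lambda> / real n ^ Suc k"
        unfolding w_def using \<rho> s n by (intro frac_le mult_left_mono) auto
      moreover have "\<rho> * digit_pos n \<tau> k i' t = \<rho> * digit_pos n \<tau> k i' 0 + \<rho> * digit_slope n k i' * t"
        using digit_pos_affine[of n \<tau> k i' t] by (simp add: algebra_simps)
      moreover have "5 * \<rho> * \<Lambda> / real n ^ Suc k = 5 * (\<rho> * \<Lambda> / real n ^ Suc k)"
        "2 * \<rho> * \<Lambda> / real n ^ Suc k = 2 * (\<rho> * \<Lambda> / real n ^ Suc k)"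
        by simp_all
      moreover have "v + \<rho> * digit_pos n \<tau> n i t \<le> x \<bullet> f" "x \<bullet> f \<le> v + \<rho> * digit_pos n \<tau> n i t + w"
        using lo hi by (simp_all add: pos[symmetric] t_def)
      moreover have "\<rho> * digit_slope n k i' * t = \<rho> * digit_slope n k i' * (x \<bullet> e) - \<rho> * digit_slope n k i' * \<beta>"
        by (simp add: t_def right_diff_distrib)
      ultimately have "x \<in> P k i'"
        using close k k2 unfolding P_def parallelogram_def mem_Collect_eq abs_le_iff t_def
        by (intro conjI) linarith+
      then show ?thesis using kn i' by (auto simp: far_def)
    qed
    show "\<exists>T. T \<in> lmeasurable \<and> measure lebesgue T \<le> \<kappa> * (real (n ^ n) * w) \<and>
       {x. \<beta> \<le> x \<bullet> e \<and> x \<bullet> e \<le> \<beta> + \<Lambda> \<and>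
         (\<exists>i<n ^ n. c i + v + a i * (x \<bullet> e - \<beta>) \<le> x \<bullet> f \<and> x \<bullet> f \<le> c i + v + a i * (x \<bullet> e - \<beta>) + w)} \<subseteq> T"
      by (rule exI[of _ "near \<union> far"]) (use near(1) far(1) meas sub in \<open>auto intro: fmeasurable.Un\<close>)
  qed
qed

section \<open>Covering a slab by strips with small continuation\<close>

text \<open>Half-open, so that the translates of a strip by multiples of its width partition the
  plane.\<close>

definition strip :: "real^2 \<Rightarrow> real^2 \<Rightarrow> real \<Rightarrow> real \<Rightarrow> real \<Rightarrow> (real^2) set" where
  "strip e f w a c = {x. c \<le> x \<bullet> f - a * (x \<bullet> e) \<and> x \<bullet> f - a * (x \<bullet> e) < c + w}"

lemma strip_borel [measurable]: "strip e f w a c \<in> sets borel"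
  unfolding strip_def by measurable

text \<open>Every round captures at least the fraction \<theta> of what is still uncovered, so the
  remainder decays geometrically.\<close>

lemma greedy_cover:
  assumes V0: "V0 \<in> lmeasurable" and \<theta>: "\<theta> \<le> 1"
    and C: "\<And>j. C j \<in> sets borel"
    and step: "\<And>V. V \<in> lmeasurable \<Longrightarrow> V \<subseteq> V0 \<Longrightarrow> \<exists>j. \<theta> * measure lebesgue V \<le> measure lebesgue (V \<inter> C j)"
  shows "\<exists>js. measure lebesgue (V0 - (\<Union>q<m. C (js q))) \<le> (1 - \<theta>) ^ m * measure lebesgue V0"
proof (induction m)
  case (Suc m)
  then obtain js where js: "measure lebesgue (V0 - (\<Union>q<m. C (js q))) \<le> (1 - \<theta>) ^ m * measure lebesgue V0"
    by blast
  define V where "V = V0 - (\<Union>q<m. C (js q))"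
  have Cl: "C j \<in> sets lebesgue" for j using C[of j] by simp
  have V: "V \<in> lmeasurable"
    unfolding V_def using V0 Cl by (intro fmeasurable_Diff) auto
  obtain j where j: "\<theta> * measure lebesgue V \<le> measure lebesgue (V \<inter> C j)"
    using step[OF V] by (auto simp: V_def)
  define js' where "js' = js(m := j)"
  have eq: "V0 - (\<Union>q<Suc m. C (js' q)) = V - C j"
    by (auto simp: V_def js'_def less_Suc_eq)
  have "measure lebesgue V = measure lebesgue (V \<inter> C j) + measure lebesgue (V - C j)"
    using measurable_measure_Diff[of V lebesgue "V \<inter> C j"] V Cl[of j]
    by (simp add: fmeasurableD Diff_Int)
  then have "measure lebesgue (V - C j) \<le> (1 - \<theta>) * measure lebesgue V"
    using j by (simp add: algebra_simps)
  also have "\<dots> \<le> (1 - \<theta>) * ((1 - \<theta>) ^ m * measure lebesgue V0)"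
    using js \<theta> by (intro mult_left_mono) (auto simp: V_def)
  finally show ?case using eq by (metis mult.assoc power_Suc)
qed simp

text \<open>For each i, every point of V lies in exactly one of the sets \<open>S j i\<close>, so some j captures its fair share of V.\<close>

lemma averaging_step:
  fixes N :: nat and Js :: "'j set"
  assumes V: "V \<in> lmeasurable" and S: "\<And>j i. S j i \<in> sets lebesgue"
    and Js: "finite Js" "Js \<noteq> {}" "real (card Js) \<le> K"
    and idx: "\<And>x i. x \<in> V \<Longrightarrow> idx x i \<in> Js" "\<And>x i j. x \<in> V \<Longrightarrow> x \<in> S j i \<longleftrightarrow> idx x i = j"
    and disj: "\<And>j. disjoint_family_on (\<lambda>i. V \<inter> S j i) {..<N}"
  shows "\<exists>j. real N / K * measure lebesgue V \<le> measure lebesgue (V \<inter> (\<Union>i<N. S j i))"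
proof -
  have VS: "V \<inter> S j i \<in> sets lebesgue" "emeasure lebesgue (V \<inter> S j i) \<noteq> \<infinity>" for j i
    using fmeasurable_Int_fmeasurable[OF V S[of j i]] by (auto simp: fmeasurable_def)
  have K: "0 < K" using Js by (metis card_gt_0_iff less_le_trans of_nat_0_less_iff)
  have inner: "measure lebesgue (V \<inter> (\<Union>i<N. S j i)) = (\<Sum>i<N. measure lebesgue (V \<inter> S j i))" for j
  proof -
    have "V \<inter> (\<Union>i<N. S j i) = (\<Union>i<N. V \<inter> S j i)" by auto
    then show ?thesis
      using measure_finite_Union[OF _ _ disj[of j], of lebesgue] VS by (simp add: image_subset_iff)
  qed
  have outer: "(\<Sum>j\<in>Js. measure lebesgue (V \<inter> S j i)) = measure lebesgue V" for i
  proof -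
    have "disjoint_family_on (\<lambda>j. V \<inter> S j i) Js"
      using idx(2) by (auto simp: disjoint_family_on_def)
    moreover have "(\<Union>j\<in>Js. V \<inter> S j i) = V"
      using idx by auto
    ultimately show ?thesis
      using measure_finite_Union[of Js "\<lambda>j. V \<inter> S j i" lebesgue] VS Js(1)
      by (simp add: image_subset_iff)
  qed
  \<comment> \<open>Double counting: summed over all j, the captured areas count every point of V
    once for each of the N indices i. If every j captured less than the average, the sum could not
    reach this total.\<close>
  have tot: "(\<Sum>j\<in>Js. measure lebesgue (V \<inter> (\<Union>i<N. S j i))) = real N * measure lebesgue V"
    unfolding inner by (subst sum.swap) (simp add: outer)
  show ?thesis
  proof (rule ccontr)
    assume "\<not> ?thesis"
    then have less: "measure lebesgue (V \<inter> (\<Union>i<N. S j i)) < real N / K * measure lebesgue V" for j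
      by (simp add: not_le)
    have "(\<Sum>j\<in>Js. measure lebesgue (V \<inter> (\<Union>i<N. S j i))) < real (card Js) * (real N / K * measure lebesgue V)"
      using Js less by (intro sum_bounded_above_strict) (auto simp: card_gt_0_iff)
    also have "\<dots> \<le> K * (real N / K * measure lebesgue V)"
      using Js K by (intro mult_right_mono) auto
    finally show False using tot K by simp
  qed
qed

text \<open>One Kakeya family is shifted in direction f by multiples of w; greedily chosen shifts
  cover the slab, and each brings its own trench beyond \<open>\<beta>\<close>. The bound on
  \<open>\<rho> * w * real N\<close> limits the height differences by which cells in overlapping
  strips are staggered later.\<close>

lemma slab_strips:
  assumes ef: "orthonormal2 e f" and \<alpha>\<beta>: "\<alpha> < \<beta>" and R: "0 < R" and \<eta>: "0 < \<eta>"
  obtains N :: nat and w \<rho> :: real and a c :: "nat \<Rightarrow> real"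
  where "0 < w" "0 \<le> \<rho>" "\<rho> \<le> 1" "\<rho> \<le> \<eta>" "\<rho> * w * real N \<le> \<eta>"
    "\<And>i. 0 \<le> a i \<and> a i \<le> \<rho>"
    "measure lebesgue (cball 0 R \<inter> {x. \<alpha> \<le> x \<bullet> e \<and> x \<bullet> e < \<beta>} - (\<Union>i<N. strip e f w (a i) (c i))) \<le> \<eta>"
    "measure lebesgue (cball 0 R \<inter> {x. \<beta> \<le> x \<bullet> e} \<inter> (\<Union>i<N. strip e f w (a i) (c i))) \<le> \<eta>"
proof -
  define H where "H = \<beta> - \<alpha>"
  \<comment> \<open>Long enough that the part of the disc beyond \<open>\<beta>\<close> lies at
    heights between \<open>\<beta>\<close> and \<open>\<beta> + \<Lambda>\<close>.\<close>
  define \<Lambda> where "\<Lambda> = R + \<bar>\<beta>\<bar>"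
  define B where "B = R + H + \<Lambda>"
  \<comment> \<open>E / w will bound the number of relevant shifts: their indices run over both
    signs up to B / w rounded up, which gives at most 2 (B / w + 1) + 1 of them, and w \<le>
    1.\<close>
  define E where "E = 2 * B + 3"
  have H: "0 < H" and \<Lambda>: "0 < \<Lambda>" and B: "0 < B" and E: "3 \<le> E"
    using \<alpha>\<beta> R by (auto simp: H_def \<Lambda>_def B_def E_def)
  define V0 :: "(real^2) set" where "V0 = cball 0 R \<inter> {x. \<alpha> \<le> x \<bullet> e \<and> x \<bullet> e < \<beta>}"
  have "{x. \<alpha> \<le> x \<bullet> e \<and> x \<bullet> e < \<beta>} \<in> sets borel" by measurable
  then have V0: "V0 \<in> lmeasurable"
    unfolding V0_def by (intro fmeasurable_Int_fmeasurable) auto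
  define \<mu> where "\<mu> = measure lebesgue V0"
  \<comment> \<open>With \<omega> the total width of one family, a round captures the fraction
    \<omega> / E, so about E * l0 / \<omega> rounds leave at most exp (- l0) * \<mu>. The summand 1
    keeps the logarithm defined when the slab misses the disc.\<close>
  define l0 where "l0 = max 0 (ln ((\<mu> + 1) / \<eta>))"
  have \<mu>0: "0 \<le> \<mu>" by (simp add: \<mu>_def)
  have l0: "0 \<le> l0" "exp (- l0) * \<mu> \<le> \<eta>"
  proof -
    show "0 \<le> l0" by (simp add: l0_def)
    have "exp (- l0) \<le> exp (- ln ((\<mu> + 1) / \<eta>))" by (simp add: l0_def)
    also have "\<dots> = \<eta> / (\<mu> + 1)" using \<mu>0 \<eta> by (simp add: exp_minus)
    finally have "exp (- l0) * \<mu> \<le> \<eta> / (\<mu> + 1) * \<mu>" using \<mu>0 by (rule mult_right_mono)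
    also have "\<dots> \<le> \<eta>" using \<mu>0 \<eta> by (simp add: field_simps)
    finally show "exp (- l0) * \<mu> \<le> \<eta>" .
  qed
  \<comment> \<open>G will bound the number of rounds times the total width \<omega> \<le> 1 of a
    family. It does not involve the strips, so \<kappa> and \<rho> can be divided by it before the
    strips are constructed.\<close>
  define G where "G = E * l0 + 1"
  have G: "1 \<le> G" using E l0 by (simp add: G_def)
  define \<kappa> where "\<kappa> = \<eta> / G"
  define \<rho> where "\<rho> = min (\<eta> / G) (min \<eta> 1)"
  have \<kappa>: "0 < \<kappa>" and \<rho>: "0 < \<rho>" "\<rho> \<le> 1" "\<rho> \<le> \<eta>" "\<rho> \<le> \<eta> / G"
    using \<eta> G by (auto simp: \<kappa>_def \<rho>_def)
  obtain N :: nat and w :: real and a c :: "nat \<Rightarrow> real" where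
    N: "0 < N" and w: "0 < w" and Nw1: "real N * w \<le> 1"
    and a: "\<And>i. 0 \<le> a i \<and> a i \<le> \<rho>" and c: "\<And>i. \<bar>c i\<bar> \<le> \<Lambda>"
    and sep: "\<And>i j t. i < N \<Longrightarrow> j < N \<Longrightarrow> i \<noteq> j \<Longrightarrow> t \<le> 0 \<Longrightarrow> w \<le> \<bar>(c i + a i * t) - (c j + a j * t)\<bar>"
    and trench: "\<And>\<beta> v. \<exists>T. T \<in> lmeasurable \<and> measure lebesgue T \<le> \<kappa> * (real N * w) \<and>
       {x. \<beta> \<le> x \<bullet> e \<and> x \<bullet> e \<le> \<beta> + \<Lambda> \<and>
         (\<exists>i<N. c i + v + a i * (x \<bullet> e - \<beta>) \<le> x \<bullet> f \<and> x \<bullet> f \<le> c i + v + a i * (x \<bullet> e - \<beta>) + w)} \<subseteq> T"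
    by (rule kakeya_strips[OF ef \<Lambda> \<kappa> \<rho>(1,2)]) (rule that)
  define \<omega> where "\<omega> = real N * w"
  have \<omega>: "0 < \<omega>" "\<omega> \<le> 1" using N w Nw1 by (auto simp: \<omega>_def)
  have "1 * w \<le> real N * w" using N w by (intro mult_right_mono) auto
  then have w1: "w \<le> 1" using Nw1 by linarith
  define S where "S j i = strip e f w (a i) (c i + real_of_int j * w - a i * \<beta>)" for j :: int and i
  have S_iff: "x \<in> S j i \<longleftrightarrow>
      real_of_int j * w \<le> x \<bullet> f - (c i + a i * (x \<bullet> e - \<beta>)) \<and> x \<bullet> f - (c i + a i * (x \<bullet> e - \<beta>)) < real_of_int j * w + w" for x j i
    by (auto simp: S_def strip_def algebra_simps)
  \<comment> \<open>For a fixed slope index i the shifts tile the plane, and the floor picks the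
    unique tile that contains x.\<close>
  have S_floor: "x \<in> S j i \<longleftrightarrow> \<lfloor>(x \<bullet> f - (c i + a i * (x \<bullet> e - \<beta>))) / w\<rfloor> = j" for x j i
    unfolding S_iff floor_eq_iff using w by (simp add: field_simps)
  define C where "C j = (\<Union>i<N. S j i)" for j
  have Sl: "S j i \<in> sets lebesgue" for j i by (simp add: S_def)
  have Cb: "C j \<in> sets borel" for j unfolding C_def S_def by auto
  define Bw where "Bw = B / w"
  define J :: int where "J = \<lceil>Bw\<rceil>"
  define Js where "Js = {-J..J}"
  have "0 \<le> Bw" using B w by (simp add: Bw_def)
  then have J: "0 \<le> J" unfolding J_def by linarith
  have Jle: "real_of_int J \<le> Bw + 1" unfolding J_def by (rule of_int_ceiling_le_add_one)
  have cardJs: "0 < real (card Js)" "real (card Js) \<le> E / w"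
  proof -
    have "real (card Js) = 2 * real_of_int J + 1" using J by (simp add: Js_def)
    also have "\<dots> \<le> 2 * (Bw + 1) + 1" by (intro add_mono mult_left_mono Jle) auto
    also have "\<dots> \<le> 2 * Bw + 3 / w" using w w1 by (simp add: field_simps)
    also have "\<dots> = E / w" by (simp add: E_def Bw_def add_divide_distrib)
    finally show "real (card Js) \<le> E / w" .
    show "0 < real (card Js)" using \<open>real (card Js) = _\<close> J by linarith
  qed
  have range: "\<lfloor>(x \<bullet> f - (c i + a i * (x \<bullet> e - \<beta>))) / w\<rfloor> \<in> Js" if x: "x \<in> V0" for x i
  proof -
    have "\<bar>x \<bullet> f\<bar> \<le> R"
      using x Cauchy_Schwarz_ineq2[of x f] ef by (auto simp: V0_def orthonormal2_def)
    moreover have "\<bar>a i * (x \<bullet> e - \<beta>)\<bar> \<le> 1 * H"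
      unfolding abs_mult using a[of i] \<rho> x by (intro mult_mono) (auto simp: V0_def H_def)
    ultimately have "\<bar>x \<bullet> f - (c i + a i * (x \<bullet> e - \<beta>))\<bar> \<le> B"
      using c[of i] unfolding B_def by linarith
    then have "\<bar>(x \<bullet> f - (c i + a i * (x \<bullet> e - \<beta>))) / w\<bar> \<le> Bw"
      using w by (simp add: Bw_def abs_divide divide_right_mono)
    then have "- Bw \<le> (x \<bullet> f - (c i + a i * (x \<bullet> e - \<beta>))) / w" "(x \<bullet> f - (c i + a i * (x \<bullet> e - \<beta>))) / w \<le> Bw"
      by (metis abs_le_iff minus_le_iff)+
    moreover have "Bw \<le> real_of_int J" unfolding J_def by (rule le_of_int_ceiling)
    ultimately show ?thesis unfolding Js_def by (simp add: le_floor_iff floor_le_iff)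
  qed
  have step: "\<exists>j. \<omega> / E * measure lebesgue V \<le> measure lebesgue (V \<inter> C j)"
    if V: "V \<in> lmeasurable" "V \<subseteq> V0" for V
  proof -
    have disj: "disjoint_family_on (\<lambda>i. V \<inter> S j i) {..<N}" for j
    proof (unfold disjoint_family_on_def, intro ballI impI)
      fix i i' assume ii: "i \<in> {..<N}" "i' \<in> {..<N}" "i \<noteq> i'"
      show "V \<inter> S j i \<inter> (V \<inter> S j i') = {}"
      proof (rule ccontr)
        assume "V \<inter> S j i \<inter> (V \<inter> S j i') \<noteq> {}"
        then obtain x where x: "x \<in> V" "x \<in> S j i" "x \<in> S j i'" by blast
        have "x \<bullet> e - \<beta> \<le> 0" using x V by (auto simp: V0_def)
        then have "w \<le> \<bar>(c i + a i * (x \<bullet> e - \<beta>)) - (c i' + a i' * (x \<bullet> e - \<beta>))\<bar>"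
          using ii by (intro sep) auto
        then show False using x(2,3) unfolding S_iff by linarith
      qed
    qed
    have "\<exists>j. real N / (E / w) * measure lebesgue V \<le> measure lebesgue (V \<inter> (\<Union>i<N. S j i))"
    proof (rule averaging_step[OF V(1) Sl _ _ cardJs(2) _ S_floor disj])
      show "finite Js" by (simp add: Js_def)
      show "Js \<noteq> {}" using cardJs(1) by auto
      show "\<lfloor>(x \<bullet> f - (c i + a i * (x \<bullet> e - \<beta>))) / w\<rfloor> \<in> Js" if "x \<in> V" for x i
        using range V that by blast
    qed
    then show ?thesis by (simp add: C_def \<omega>_def)
  qed
  have \<theta>: "\<omega> / E \<le> 1" using \<omega> E by simp
  define m where "m = nat \<lceil>E * l0 / \<omega>\<rceil>"
  have m: "E * l0 / \<omega> \<le> real m" "real m \<le> E * l0 / \<omega> + 1"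
  proof -
    show "E * l0 / \<omega> \<le> real m" unfolding m_def by (rule real_nat_ceiling_ge)
    have "0 \<le> E * l0 / \<omega>" using E l0 \<omega> by simp
    then have "real m = real_of_int \<lceil>E * l0 / \<omega>\<rceil>" by (simp add: m_def)
    also have "\<dots> \<le> E * l0 / \<omega> + 1" by (rule of_int_ceiling_le_add_one)
    finally show "real m \<le> E * l0 / \<omega> + 1" .
  qed
  have mG: "real m * \<omega> \<le> G"
  proof -
    have "real m * \<omega> \<le> (E * l0 / \<omega> + 1) * \<omega>" using m \<omega> by (intro mult_right_mono) auto
    also have "\<dots> \<le> G" using \<omega> by (simp add: G_def field_simps)
    finally show ?thesis .
  qed
  obtain js where js: "measure lebesgue (V0 - (\<Union>q<m. C (js q))) \<le> (1 - \<omega> / E) ^ m * \<mu>"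
    using greedy_cover[OF V0 \<theta> Cb step, of m] unfolding \<mu>_def by blast
  have small: "(1 - \<omega> / E) ^ m * \<mu> \<le> \<eta>"
  proof -
    have "(1 - \<omega> / E) ^ m \<le> exp (- (\<omega> / E)) ^ m"
      using exp_ge_add_one_self[of "- (\<omega> / E)"] \<theta> by (intro power_mono) auto
    also have "\<dots> = exp (- (real m * (\<omega> / E)))"
      by (simp add: exp_of_nat_mult[symmetric])
    also have "\<dots> \<le> exp (- l0)"
      using m(1) E \<omega> by (simp add: field_simps)
    finally have "(1 - \<omega> / E) ^ m * \<mu> \<le> exp (- l0) * \<mu>" using \<mu>0 by (rule mult_right_mono)
    then show ?thesis using l0 by linarith
  qed
  define a' where "a' l = a (l mod N)" for l
  define c' where "c' l = c (l mod N) + real_of_int (js (l div N)) * w - a (l mod N) * \<beta>" for l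
  have union: "(\<Union>l<m * N. strip e f w (a' l) (c' l)) = (\<Union>q<m. C (js q))"
  proof (intro equalityI subsetI)
    fix x assume "x \<in> (\<Union>l<m * N. strip e f w (a' l) (c' l))"
    then obtain l where l: "l < m * N" "x \<in> S (js (l div N)) (l mod N)"
      by (auto simp: S_def a'_def c'_def)
    moreover have "l div N < m" "l mod N < N" using l N by (auto simp: less_mult_imp_div_less)
    ultimately show "x \<in> (\<Union>q<m. C (js q))" by (auto simp: C_def)
  next
    fix x assume "x \<in> (\<Union>q<m. C (js q))"
    then obtain q i where qi: "q < m" "i < N" "x \<in> S (js q) i" by (auto simp: C_def)
    define l where "l = q * N + i"
    have "l div N = q" "l mod N = i" using qi by (auto simp: l_def)
    moreover have "l < m * N"
    proof -
      have "l < Suc q * N" using qi by (simp add: l_def)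
      also have "\<dots> \<le> m * N" using qi by (intro mult_right_mono) auto
      finally show ?thesis .
    qed
    ultimately show "x \<in> (\<Union>l<m * N. strip e f w (a' l) (c' l))"
      using qi by (auto simp: S_def a'_def c'_def)
  qed
  have "\<forall>q. \<exists>T. T \<in> lmeasurable \<and> measure lebesgue T \<le> \<kappa> * \<omega> \<and>
       {x. \<beta> \<le> x \<bullet> e \<and> x \<bullet> e \<le> \<beta> + \<Lambda> \<and>
         (\<exists>i<N. c i + real_of_int (js q) * w + a i * (x \<bullet> e - \<beta>) \<le> x \<bullet> f \<and>
           x \<bullet> f \<le> c i + real_of_int (js q) * w + a i * (x \<bullet> e - \<beta>) + w)} \<subseteq> T"
    unfolding \<omega>_def by (intro allI trench)
  from choice[OF this] obtain T where T: "\<And>q. T q \<in> lmeasurable \<and> measure lebesgue (T q) \<le> \<kappa> * \<omega> \<and>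
       {x. \<beta> \<le> x \<bullet> e \<and> x \<bullet> e \<le> \<beta> + \<Lambda> \<and>
         (\<exists>i<N. c i + real_of_int (js q) * w + a i * (x \<bullet> e - \<beta>) \<le> x \<bullet> f \<and>
           x \<bullet> f \<le> c i + real_of_int (js q) * w + a i * (x \<bullet> e - \<beta>) + w)} \<subseteq> T q"
    by blast
  have Tm: "(\<Union>q\<in>{..<m}. T q) \<in> lmeasurable" "measure lebesgue (\<Union>q\<in>{..<m}. T q) \<le> real m * (\<kappa> * \<omega>)"
    using measure_finite_UN_le_card[of "{..<m}" T "\<kappa> * \<omega>"] T by auto
  have sub: "cball 0 R \<inter> {x. \<beta> \<le> x \<bullet> e} \<inter> (\<Union>q<m. C (js q)) \<subseteq> (\<Union>q\<in>{..<m}. T q)"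
  proof
    fix x assume "x \<in> cball 0 R \<inter> {x. \<beta> \<le> x \<bullet> e} \<inter> (\<Union>q<m. C (js q))"
    then obtain q i where x: "norm x \<le> R" "\<beta> \<le> x \<bullet> e" "q < m" "i < N" "x \<in> S (js q) i"
      by (auto simp: C_def)
    have "\<bar>x \<bullet> e\<bar> \<le> R"
      using x Cauchy_Schwarz_ineq2[of x e] ef by (auto simp: orthonormal2_def)
    then have "x \<bullet> e \<le> \<beta> + \<Lambda>" by (simp add: \<Lambda>_def)
    moreover have "c i + real_of_int (js q) * w + a i * (x \<bullet> e - \<beta>) \<le> x \<bullet> f"
      "x \<bullet> f \<le> c i + real_of_int (js q) * w + a i * (x \<bullet> e - \<beta>) + w"
      using x(5) unfolding S_iff by auto
    ultimately have "x \<in> T q" using T[of q] x by blast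
    then show "x \<in> (\<Union>q\<in>{..<m}. T q)" using x by blast
  qed
  show thesis
  proof (rule that[of w \<rho> "m * N" a' c'])
    show "0 < w" "0 \<le> \<rho>" "\<rho> \<le> 1" "\<rho> \<le> \<eta>" using w \<rho> by auto
    show "\<rho> * w * real (m * N) \<le> \<eta>"
    proof -
      have "\<rho> * w * real (m * N) = \<rho> * (real m * \<omega>)" by (simp add: \<omega>_def)
      also have "\<dots> \<le> \<eta> / G * G" using \<rho> mG \<omega> by (intro mult_mono) auto
      finally show ?thesis using G by simp
    qed
    show "0 \<le> a' i \<and> a' i \<le> \<rho>" for i using a by (simp add: a'_def)
    show "measure lebesgue (cball 0 R \<inter> {x. \<alpha> \<le> x \<bullet> e \<and> x \<bullet> e < \<beta>} - (\<Union>i<m * N. strip e f w (a' i) (c' i))) \<le> \<eta>"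
      unfolding union V0_def[symmetric] using js small by linarith
    have "{x. \<beta> \<le> x \<bullet> e} \<in> sets borel" by measurable
    then have "cball 0 R \<inter> {x. \<beta> \<le> x \<bullet> e} \<inter> (\<Union>q<m. C (js q)) \<in> lmeasurable"
      using Cb by (intro fmeasurable_Int_fmeasurable) auto
    then have "measure lebesgue (cball 0 R \<inter> {x. \<beta> \<le> x \<bullet> e} \<inter> (\<Union>q<m. C (js q))) \<le> measure lebesgue (\<Union>q\<in>{..<m}. T q)"
      using Tm sub by (intro measure_mono_fmeasurable) (auto simp: fmeasurableD)
    also have "\<dots> \<le> \<kappa> * (real m * \<omega>)" using Tm by (simp add: mult_ac)
    also have "\<dots> \<le> \<kappa> * G" using mG \<kappa> by (intro mult_left_mono) auto
    also have "\<dots> = \<eta>" using G by (simp add: \<kappa>_def)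
    finally show "measure lebesgue (cball 0 R \<inter> {x. \<beta> \<le> x \<bullet> e} \<inter> (\<Union>i<m * N. strip e f w (a' i) (c' i))) \<le> \<eta>"
      unfolding union .
  qed
qed

section \<open>The lower bound\<close>

lemma grad_eq:
  assumes "GDERIV u x :> D"
  shows "grad u x = D"
  unfolding grad_def
proof (rule the_equality)
  show "GDERIV u x :> D" by (rule assms)
next
  fix D' assume "GDERIV u x :> D'"
  then have "(\<lambda>h. h \<bullet> D') = (\<lambda>h. h \<bullet> D)"
    using assms unfolding gderiv_def by (rule has_derivative_unique)
  then show "D' = D"
    by (metis vector_eq_ldot)
qed

lemma smooth_on_GDERIV:
  assumes "smooth_on U u"
  shows "\<And>x. x \<in> U \<Longrightarrow> GDERIV u x :> grad u x" and "continuous_on U (grad u)"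
proof -
  have "Ck_on (Suc 0) U u" using assms by (simp add: smooth_on_def)
  then obtain g where g: "\<And>x. x \<in> U \<Longrightarrow> GDERIV u x :> g x" "\<And>i. continuous_on U (\<lambda>x. g x $ i)"
    by auto
  have eq: "grad u x = g x" if "x \<in> U" for x
    using g(1)[OF that] by (rule grad_eq)
  show "\<And>x. x \<in> U \<Longrightarrow> GDERIV u x :> grad u x" using g eq by simp
  have "continuous_on U (\<lambda>x. \<chi> i. g x $ i)"
    using g(2) by (intro continuous_on_vec_lambda)
  then show "continuous_on U (grad u)"
    using eq by (simp cong: continuous_on_cong)
qed

lemma negligible_path_image:
  fixes c :: "real \<Rightarrow> real^2"
  assumes "valid_path c"
  shows "negligible (path_image c)"
proof -
  obtain S where S: "finite S" "c C1_differentiable_on ({0..1} - S)"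
    using assms unfolding valid_path_def piecewise_C1_differentiable_on_def by blast
  have "c differentiable_on ({0..1} - S)"
    using S(2) unfolding C1_differentiable_on_eq differentiable_on_def
    by (auto intro: differentiable_at_withinI)
  then have "negligible (c ` ({0..1} - S))"
    by (intro negligible_differentiable_image_lowdim) auto
  moreover have "negligible (c ` S)" using S by (simp add: negligible_finite)
  moreover have "path_image c \<subseteq> c ` ({0..1} - S) \<union> c ` S"
    unfolding path_image_def by blast
  ultimately show ?thesis by (meson negligible_Un negligible_subset)
qed

text \<open>Images of valid paths are compact and, being one-dimensional C1 images up to finitely
  many points, null; removing finitely many of them leaves an open set of full measure.\<close>

lemma piecewise_smooth_open_part:
  assumes "open \<Omega>" and "piecewise_smooth \<Omega> u"
  obtains W where "open W" "W \<subseteq> \<Omega>" "negligible (\<Omega> - W)" "smooth_on W u"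
proof -
  obtain C where C: "finite C" "\<forall>c\<in>C. valid_path c" "smooth_on (\<Omega> - (\<Union>c\<in>C. path_image c)) u"
    using assms(2) unfolding piecewise_smooth_def by blast
  have cl: "closed (\<Union>c\<in>C. path_image c)"
    using C by (intro closed_UN) (auto simp: compact_imp_closed compact_valid_path_image)
  have "negligible (\<Union>c\<in>C. path_image c)"
    using C by (intro negligible_Union) (auto simp: negligible_path_image)
  then have "negligible (\<Omega> - (\<Omega> - (\<Union>c\<in>C. path_image c)))"
    by (rule negligible_subset) auto
  then show thesis
    using that[of "\<Omega> - (\<Union>c\<in>C. path_image c)"] cl C(3) assms(1) by auto
qed

lemma bounded_continuous_set_integrable:
  fixes f :: "real^2 \<Rightarrow> real"
  assumes "open S" "bounded S" "continuous_on S f" "\<And>x. x \<in> S \<Longrightarrow> \<bar>f x\<bar> \<le> B"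
  shows "set_integrable lebesgue S f"
proof -
  have S: "S \<in> lmeasurable" using assms lmeasurable_open by blast
  have "f \<in> borel_measurable (lebesgue_on S)"
    using assms S by (intro continuous_imp_measurable_on_sets_lebesgue) auto
  then show ?thesis
    using assms S
    by (intro measurable_bounded_by_integrable_imp_absolutely_integrable[where g="\<lambda>_. B"])
       (auto intro: integrable_on_const)
qed

lemma resistance_integrable:
  assumes "open \<Omega>" "bounded \<Omega>" "piecewise_smooth \<Omega> u"
  shows "set_integrable lebesgue \<Omega> (\<lambda>x. 1 / (1 + (norm (grad u x))\<^sup>2))"
proof -
  obtain W where W: "open W" "W \<subseteq> \<Omega>" "negligible (\<Omega> - W)" "smooth_on W u"
    using piecewise_smooth_open_part[OF assms(1,3)] .
  have nz: "1 + (norm y)\<^sup>2 \<noteq> 0" for y :: "real^2"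
    by (smt (verit) zero_le_power2)
  have bd: "bounded W" using W assms bounded_subset by blast
  have "continuous_on W (\<lambda>x. 1 / (1 + (norm (grad u x))\<^sup>2))"
    using nz by (intro continuous_intros smooth_on_GDERIV(2)[OF W(4)]) auto
  then have "set_integrable lebesgue W (\<lambda>x. 1 / (1 + (norm (grad u x))\<^sup>2))"
  proof (rule bounded_continuous_set_integrable[OF W(1) bd])
    show "\<bar>1 / (1 + (norm (grad u x))\<^sup>2)\<bar> \<le> 1" for x
      by (simp add: abs_divide divide_le_eq_1 add_pos_nonneg)
  qed
  then show ?thesis
    by (rule absolutely_integrable_spike_set) (use W in \<open>auto intro: negligible_subset\<close>)
qed

text \<open>The integrand of \<open>phi\<close> as a function of the distance alone. It is separated
  from the domain because the construction evaluates it with a slightly smaller \<open>M\<close> and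
  at a nearby point.\<close>

definition optimal_density :: "real \<Rightarrow> real \<Rightarrow> real" where
  "optimal_density M d = 1/2 * (1 - M / sqrt (M\<^sup>2 + d\<^sup>2))"

lemma phi_eq: "phi \<Omega> M = (LINT x:\<Omega>|lebesgue. optimal_density M (infdist x (frontier \<Omega>)))"
  by (simp add: phi_def optimal_density_def)

lemma optimal_density_bounds:
  assumes "0 < M"
  shows "0 \<le> optimal_density M d" "optimal_density M d \<le> 1/2"
proof -
  have "0 < M\<^sup>2 + d\<^sup>2" using assms by (simp add: add_pos_nonneg)
  moreover have "M \<le> sqrt (M\<^sup>2 + d\<^sup>2)" by (rule real_le_rsqrt) simp
  ultimately show "0 \<le> optimal_density M d" "optimal_density M d \<le> 1/2"
    using assms by (auto simp: optimal_density_def)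
qed

lemma optimal_density_integrable:
  fixes \<Omega> :: "(real^2) set"
  assumes "open \<Omega>" "bounded \<Omega>" "0 < M"
  shows "set_integrable lebesgue \<Omega> (\<lambda>x. optimal_density M (infdist x (frontier \<Omega>)))"
proof (rule bounded_continuous_set_integrable[OF assms(1,2), where B="1/2"])
  have "sqrt (M\<^sup>2 + d\<^sup>2) \<noteq> 0" for d
    using assms(3) by (simp add: add_pos_nonneg less_imp_neq[symmetric])
  then show "continuous_on \<Omega> (\<lambda>x. optimal_density M (infdist x (frontier \<Omega>)))"
    unfolding optimal_density_def by (intro continuous_intros) auto
  show "\<bar>optimal_density M (infdist x (frontier \<Omega>))\<bar> \<le> 1/2" for x
    using optimal_density_bounds[OF assms(3)] by (simp add: abs_le_iff)
qed

text \<open>With s = sqrt (M^2 + d^2) the hypothesis is (d g - M)^2 \<le> s^2, hence d g \<le> s +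
  M. Since d^2 = (s - M) (s + M), this turns into (s - M) g^2 \<le> s + M, which is the
  claim.\<close>

lemma optimal_density_le:
  assumes M: "0 < M" and d: "0 < d" and g: "0 \<le> g" "(g\<^sup>2 - 1) * d \<le> 2 * M * g"
  shows "optimal_density M d \<le> 1 / (1 + g\<^sup>2)"
proof -
  define s where "s = sqrt (M\<^sup>2 + d\<^sup>2)"
  have s: "0 < s" "s\<^sup>2 = M\<^sup>2 + d\<^sup>2" "M < s"
  proof -
    show "s\<^sup>2 = M\<^sup>2 + d\<^sup>2" by (simp add: s_def)
    show "M < s" unfolding s_def by (rule real_less_rsqrt) (use d in simp)
    then show "0 < s" using M by simp
  qed
  have "((g\<^sup>2 - 1) * d) * d \<le> (2 * M * g) * d"
    using g d by (intro mult_right_mono) auto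
  then have "(d * g - M)\<^sup>2 \<le> s\<^sup>2"
    unfolding s by (simp add: power2_eq_square algebra_simps)
  then have "d * g - M \<le> s" using s by (intro power2_le_imp_le[of "d * g - M" s]) auto
  then have "(d * g)\<^sup>2 \<le> (s + M)\<^sup>2" using g d by (intro power_mono) auto
  then have "(s - M) * (s + M) * g\<^sup>2 \<le> (s + M) * (s + M)"
    using s(2) by (simp add: power2_eq_square algebra_simps)
  then have "(s - M) * g\<^sup>2 \<le> s + M"
    using s M by (metis add_pos_pos mult.assoc mult.commute mult_le_cancel_left_pos)
  moreover have "0 < 1 + g\<^sup>2" by (simp add: add_pos_nonneg)
  ultimately show ?thesis
    using s unfolding optimal_density_def s_def[symmetric] by (simp add: field_simps)
qed

text \<open>The witness (M + s) / d is the positive root of the quadratic, where the preceding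
  estimate is an equality. The upper bound for g makes the slopes uniformly bounded once the
  distances are bounded below.\<close>

lemma optimal_density_attained:
  assumes M: "0 < M" and d: "0 < d"
  obtains g where "1 \<le> g" "g \<le> 2 * M / d + 1" "(g\<^sup>2 - 1) * d = 2 * M * g" "1 / (1 + g\<^sup>2) = optimal_density M d"
proof -
  define s where "s = sqrt (M\<^sup>2 + d\<^sup>2)"
  have s: "s\<^sup>2 = M\<^sup>2 + d\<^sup>2" "M < s" "d \<le> s" "s \<le> M + d"
  proof -
    show "s\<^sup>2 = M\<^sup>2 + d\<^sup>2" by (simp add: s_def)
    show "M < s" unfolding s_def by (rule real_less_rsqrt) (use d in simp)
    show "d \<le> s" unfolding s_def by (rule real_le_rsqrt) simp
    show "s \<le> M + d" unfolding s_def by (rule real_le_lsqrt) (use M d in \<open>auto simp: power2_sum\<close>)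
  qed
  have s0: "0 < s" using s M by linarith
  define g where "g = (M + s) / d"
  have gd: "g * d = M + s" using d by (simp add: g_def)
  show thesis
  proof (rule that[of g])
    show "1 \<le> g" using s M d by (simp add: g_def)
    have "g \<le> (2 * M + d) / d" unfolding g_def using s d by (intro divide_right_mono) auto
    then show "g \<le> 2 * M / d + 1" using d by (simp add: add_divide_distrib)
    have "((g\<^sup>2 - 1) * d) * d = (g * d)\<^sup>2 - d\<^sup>2" by (simp add: power2_eq_square algebra_simps)
    also have "\<dots> = 2 * M * (g * d)" unfolding gd using s(1) by (simp add: power2_eq_square algebra_simps)
    finally show "(g\<^sup>2 - 1) * d = 2 * M * g" using d by simp
    have "(1 + g\<^sup>2) * d\<^sup>2 = d\<^sup>2 + (g * d)\<^sup>2" by (simp add: power2_eq_square algebra_simps)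
    also have "\<dots> = 2 * s * (s + M)" unfolding gd using s(1) by (simp add: power2_eq_square algebra_simps)
    finally have 1: "(1 + g\<^sup>2) * d\<^sup>2 = 2 * s * (s + M)" .
    have 2: "d\<^sup>2 = (s - M) * (s + M)" using s(1) by (simp add: power2_eq_square algebra_simps)
    have "(1 + g\<^sup>2) * (s - M) * (s + M) = 2 * s * (s + M)" using 1 2 by (simp add: mult.assoc)
    then have "(1 + g\<^sup>2) * (s - M) = 2 * s" using s M s0 by simp
    moreover have "0 < 1 + g\<^sup>2" by (simp add: add_pos_nonneg)
    ultimately show "1 / (1 + g\<^sup>2) = optimal_density M d"
      using s0 unfolding optimal_density_def s_def[symmetric] by (simp add: field_simps)
  qed
qed

text \<open>A segment from x to a point outside the closure meets the frontier no earlier than at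
  distance \<open>infdist x (frontier \<Omega>)\<close>, hence only at its endpoint, which would
  then belong to the closure after all.\<close>

lemma cball_infdist_frontier_subset:
  fixes \<Omega> :: "(real^2) set"
  assumes x: "x \<in> \<Omega>" and y: "dist x y \<le> infdist x (frontier \<Omega>)"
  shows "y \<in> closure \<Omega>"
proof (rule ccontr)
  assume ny: "y \<notin> closure \<Omega>"
  then have "y \<notin> \<Omega>" using closure_subset by blast
  then have "closed_segment x y \<inter> \<Omega> \<noteq> {}" "closed_segment x y - \<Omega> \<noteq> {}" using x by auto
  then obtain z where z: "z \<in> closed_segment x y" "z \<in> frontier \<Omega>"
    using connected_Int_frontier[OF connected_segment(1)] by blast
  have "infdist x (frontier \<Omega>) \<le> dist x z" using z by (intro infdist_le)
  moreover have "dist x y = dist x z + dist z y"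
    using z(1) by (metis between between_mem_segment)
  ultimately have "z = y" using y by (metis add_le_same_cancel1 dist_le_zero_iff order_trans)
  then show False using z ny by (simp add: frontier_def)
qed

lemma SIC_gradient_bound:
  assumes \<Omega>: "open \<Omega>" and u: "u \<in> admissible \<Omega> M" and x: "regular_point \<Omega> u x" "x \<in> \<Omega>"
    and d: "0 < infdist x (frontier \<Omega>)"
  shows "((norm (grad u x))\<^sup>2 - 1) * infdist x (frontier \<Omega>) \<le> 2 * M * norm (grad u x)"
proof (cases "grad u x = 0")
  case True
  then show ?thesis using d by simp
next
  case False
  define d where "d = infdist x (frontier \<Omega>)"
  define g where "g = norm (grad u x)"
  define y where "y = x - (d / g) *\<^sub>R grad u x"
  have g: "0 < g" using False by (simp add: g_def)
  have d0: "0 < d" using d by (simp add: d_def)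
  have "dist x y = d" using g d0 by (simp add: y_def dist_norm g_def)
  then have y: "y \<in> closure \<Omega>"
    using cball_infdist_frontier_subset[OF x(2)] by (simp add: d_def)
  have rng: "0 \<le> u y" "u x \<le> M"
    using u y x(2) closure_subset by (auto simp: admissible_def)
  have "(u y - u x) / (d / g) \<le> 1/2 * (1 - g\<^sup>2)"
  proof -
    have "SIC \<Omega> u" using u by (simp add: admissible_def)
    moreover have "0 < d / g" using g d0 by simp
    ultimately show ?thesis
      using x(1) y unfolding SIC_def y_def g_def by blast
  qed
  moreover have "- M / (d / g) \<le> (u y - u x) / (d / g)"
    using rng g d0 by (intro divide_right_mono) auto
  ultimately have "- M / (d / g) \<le> 1/2 * (1 - g\<^sup>2)" by (rule order_trans[rotated])
  then have "- M * g / d \<le> 1/2 * (1 - g\<^sup>2)" by simp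
  then show ?thesis
    unfolding d_def[symmetric] g_def[symmetric] using d0 by (simp add: field_simps)
qed

lemma set_lebesgue_integral_mono_negligible:
  fixes f g :: "real^2 \<Rightarrow> real"
  assumes "set_integrable lebesgue S f" "set_integrable lebesgue S g" "negligible N"
    and "\<And>x. x \<in> S - N \<Longrightarrow> f x \<le> g x"
  shows "(LINT x:S|lebesgue. f x) \<le> (LINT x:S|lebesgue. g x)"
proof (rule set_integral_mono_AE[OF assms(1,2)])
  have "N \<in> null_sets lebesgue" using assms(3) by (simp add: negligible_iff_null_sets)
  then show "AE x\<in>S in lebesgue. f x \<le> g x"
    using assms(4) by (auto dest: AE_not_in)
qed

lemma infdist_frontier_pos:
  fixes \<Omega> :: "(real^2) set"
  assumes "open \<Omega>" "bounded \<Omega>" "x \<in> \<Omega>"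
  shows "0 < infdist x (frontier \<Omega>)" and "frontier \<Omega> \<noteq> {}"
proof -
  show ne: "frontier \<Omega> \<noteq> {}"
    using assms frontier_eq_empty not_bounded_UNIV by blast
  have "x \<notin> frontier \<Omega>" using assms frontier_disjoint_eq by blast
  then show "0 < infdist x (frontier \<Omega>)"
    using ne by (simp add: infdist_pos_not_in_closed)
qed

lemma phi_le_resistance:
  assumes "open \<Omega>" "bounded \<Omega>" "0 < M" and u: "u \<in> admissible \<Omega> M"
  shows "phi \<Omega> M \<le> resistance \<Omega> u"
proof -
  have ps: "piecewise_smooth \<Omega> u" using u by (simp add: admissible_def SIC_def)
  obtain W where W: "open W" "W \<subseteq> \<Omega>" "negligible (\<Omega> - W)" "smooth_on W u"
    using piecewise_smooth_open_part[OF assms(1) ps] .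
  show ?thesis
    unfolding phi_eq resistance_def
  proof (rule set_lebesgue_integral_mono_negligible[OF optimal_density_integrable[OF assms(1-3)]
        resistance_integrable[OF assms(1,2) ps] W(3)])
    fix x assume "x \<in> \<Omega> - (\<Omega> - W)"
    then have x: "x \<in> W" "x \<in> \<Omega>" by auto
    then have "regular_point \<Omega> u x" using W unfolding regular_point_def by blast
    then show "optimal_density M (infdist x (frontier \<Omega>)) \<le> 1 / (1 + (norm (grad u x))\<^sup>2)"
      using x assms infdist_frontier_pos[OF assms(1,2)]
      by (intro optimal_density_le SIC_gradient_bound[OF _ u]) auto
  qed
qed

section \<open>Piecewise affine admissible functions\<close>

lemma locally_affine_GDERIV:
  fixes v :: "real^2"
  assumes "open U" "x \<in> U" "\<And>y. y \<in> U \<Longrightarrow> u y = v \<bullet> y + c"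
  shows "GDERIV u x :> v"
proof -
  have "((\<lambda>y. v \<bullet> y + c) has_derivative (\<lambda>h. h \<bullet> v)) (at x)"
    by (auto intro!: derivative_eq_intros simp: inner_commute)
  then show ?thesis
    unfolding gderiv_def
    by (rule has_derivative_transform_within_open[OF _ assms(1,2)]) (use assms(3) in auto)
qed

text \<open>The components of the gradient are locally constant, hence again locally affine, and the
  induction on k closes.\<close>

lemma locally_affine_Ck_on:
  assumes "\<And>x. x \<in> S \<Longrightarrow> \<exists>U v c. open U \<and> x \<in> U \<and> (\<forall>y\<in>U. u y = v \<bullet> y + c)"
  shows "Ck_on k S u"
  using assms
proof (induction k arbitrary: u)
  case 0
  have "isCont u x" if x: "x \<in> S" for x
  proof -
    obtain U v c where U: "open U" "x \<in> U" "\<And>y. y \<in> U \<Longrightarrow> u y = v \<bullet> y + c"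
      using 0[OF x] by blast
    show ?thesis
      using locally_affine_GDERIV[OF U] unfolding gderiv_def by (rule has_derivative_continuous)
  qed
  then show ?case by (auto intro: continuous_at_imp_continuous_on)
next
  case (Suc k)
  have "GDERIV u x :> grad u x" if x: "x \<in> S" for x
  proof -
    obtain U v c where U: "open U" "x \<in> U" "\<And>y. y \<in> U \<Longrightarrow> u y = v \<bullet> y + c"
      using Suc.prems[OF x] by blast
    show ?thesis
      using locally_affine_GDERIV[OF U] grad_eq[OF locally_affine_GDERIV[OF U]] by simp
  qed
  moreover have "Ck_on k S (\<lambda>x. grad u x $ i)" for i
  proof (rule Suc.IH)
    fix x assume x: "x \<in> S"
    obtain U v c where U: "open U" "x \<in> U" "\<And>y. y \<in> U \<Longrightarrow> u y = v \<bullet> y + c"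
      using Suc.prems[OF x] by blast
    have "grad u y = v" if "y \<in> U" for y
      using locally_affine_GDERIV[OF U(1) that U(3)] by (rule grad_eq)
    then have "\<forall>y\<in>U. grad u y $ i = 0 \<bullet> y + v $ i" by simp
    then show "\<exists>U v c. open U \<and> x \<in> U \<and> (\<forall>y\<in>U. grad u y $ i = v \<bullet> y + c)"
      using U(1,2) by blast
  qed
  ultimately show ?case by auto
qed

text \<open>Only the frontier is constrained and boundedness is not asked for, so half planes and
  strips qualify. This is all that the two applications need: cells have null frontiers, and their
  frontiers can be covered by an exceptional set of segments.\<close>

definition polygonal :: "(real^2) set \<Rightarrow> bool" where
  "polygonal S \<longleftrightarrow> (\<exists>F. finite F \<and> (\<forall>(a, c)\<in>F. a \<noteq> 0) \<and> frontier S \<subseteq> (\<Union>(a, c)\<in>F. {x. a \<bullet> x = c}))"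

lemma polygonal_frontier_mono:
  assumes "polygonal S" "polygonal T" "frontier A \<subseteq> frontier S \<union> frontier T"
  shows "polygonal A"
proof -
  obtain F where F: "finite F" "\<forall>(a, c)\<in>F. a \<noteq> 0" "frontier S \<subseteq> (\<Union>(a, c)\<in>F. {x. a \<bullet> x = c})"
    using assms(1) unfolding polygonal_def by blast
  obtain G where G: "finite G" "\<forall>(a, c)\<in>G. a \<noteq> 0" "frontier T \<subseteq> (\<Union>(a, c)\<in>G. {x. a \<bullet> x = c})"
    using assms(2) unfolding polygonal_def by blast
  show ?thesis
    unfolding polygonal_def
  proof (intro exI conjI)
    show "finite (F \<union> G)" "\<forall>(a, c)\<in>F \<union> G. a \<noteq> 0" using F G by auto
    show "frontier A \<subseteq> (\<Union>(a, c)\<in>F \<union> G. {x. a \<bullet> x = c})"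
      using assms(3) F(3) G(3) unfolding UN_Un by blast
  qed
qed

lemma polygonal_Un: "polygonal S \<Longrightarrow> polygonal T \<Longrightarrow> polygonal (S \<union> T)"
  by (rule polygonal_frontier_mono[OF _ _ frontier_Un_subset])

lemma polygonal_Int: "polygonal S \<Longrightarrow> polygonal T \<Longrightarrow> polygonal (S \<inter> T)"
  by (rule polygonal_frontier_mono[OF _ _ frontier_Int_subset])

lemma polygonal_Diff: "polygonal S \<Longrightarrow> polygonal T \<Longrightarrow> polygonal (S - T)"
  using polygonal_frontier_mono[of S T "S - T"] frontier_Int_subset[of S "- T"]
  by (simp add: Diff_eq frontier_complement)

lemma polygonal_interior: "polygonal S \<Longrightarrow> polygonal (interior S)"
  using polygonal_frontier_mono[of S S "interior S"] frontier_interior_subset[of S] by simp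

lemma polygonal_empty: "polygonal {}"
  unfolding polygonal_def by (rule exI[of _ "{}"]) auto

lemma polygonal_UN: "finite I \<Longrightarrow> (\<And>i. i \<in> I \<Longrightarrow> polygonal (A i)) \<Longrightarrow> polygonal (\<Union>i\<in>I. A i)"
  by (induction rule: finite_induct) (auto intro: polygonal_Un polygonal_empty)

lemma polygonal_halfspace:
  assumes "a \<noteq> 0"
  shows "polygonal {x. a \<bullet> x \<le> c}" "polygonal {x. a \<bullet> x < c}" "polygonal {x. c \<le> a \<bullet> x}" "polygonal {x. c < a \<bullet> x}"
proof -
  have *: "polygonal S" if "frontier S = {x. a \<bullet> x = c}" for S
    unfolding polygonal_def by (rule exI[of _ "{(a, c)}"]) (use that assms in auto)
  show "polygonal {x. a \<bullet> x \<le> c}" "polygonal {x. a \<bullet> x < c}" "polygonal {x. c \<le> a \<bullet> x}" "polygonal {x. c < a \<bullet> x}"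
    using frontier_halfspace_le[of a c] frontier_halfspace_lt[of a c] frontier_halfspace_ge[of a c]
      frontier_halfspace_gt[of a c] assms by (auto intro!: *)
qed

lemma polygonal_negligible_frontier:
  assumes "polygonal S"
  shows "negligible (frontier S)"
proof -
  obtain F where F: "finite F" "\<forall>(a, c)\<in>F. a \<noteq> 0" "frontier S \<subseteq> (\<Union>(a, c)\<in>F. {x. a \<bullet> x = c})"
    using assms unfolding polygonal_def by blast
  have "negligible (\<Union>(a, c)\<in>F. {x. a \<bullet> x = c})"
    using F(1,2) by (intro negligible_Union) (auto intro: negligible_hyperplane)
  then show ?thesis using F(3) negligible_subset by blast
qed

text \<open>Exceptional sets in \<open>piecewise_smooth\<close> consist of paths, so a line is cut
  down to a segment. Centred at the foot of the perpendicular from the origin, half-length R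
  suffices for the disc of radius R.\<close>

lemma line_Int_cball_subset_path:
  fixes a :: "real^2"
  assumes "a \<noteq> 0"
  obtains p where "valid_path p" "{x. a \<bullet> x = c} \<inter> cball 0 R \<subseteq> path_image p"
proof -
  define e where "e = a /\<^sub>R norm a"
  have "norm e = 1" using assms by (simp add: e_def)
  then obtain f where ef: "orthonormal2 e f" by (rule orthonormal2_ex)
  define q where "q = (c / norm a) *\<^sub>R e"
  show thesis
  proof (rule that[of "linepath (q - R *\<^sub>R f) (q + R *\<^sub>R f)"])
    show "valid_path (linepath (q - R *\<^sub>R f) (q + R *\<^sub>R f))" by (rule valid_path_linepath)
    show "{x. a \<bullet> x = c} \<inter> cball 0 R \<subseteq> path_image (linepath (q - R *\<^sub>R f) (q + R *\<^sub>R f))"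
    proof
      fix x assume x: "x \<in> {x. a \<bullet> x = c} \<inter> cball 0 R"
      then have xe: "x \<bullet> e = c / norm a"
        by (simp add: e_def inner_commute divide_inverse_commute)
      define r where "r = x \<bullet> f"
      have r: "\<bar>r\<bar> \<le> R"
        using x Cauchy_Schwarz_ineq2[of x f] ef by (auto simp: r_def orthonormal2_def)
      have x_eq: "x = r *\<^sub>R f + q"
        using orthonormal2_expand[OF ef, of x] unfolding xe r_def q_def .
      show "x \<in> path_image (linepath (q - R *\<^sub>R f) (q + R *\<^sub>R f))"
      \<comment> \<open>For R = 0 the segment is a single point, and the parameter used in the other
        case would divide by zero.\<close>
      proof (cases "R = 0")
        case True
        then show ?thesis using r x_eq by simp
      next
        case False
        then have R: "0 < R" using r by linarith
        define t where "t = (r + R) / (2 * R)"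
        have "0 \<le> t" "t \<le> 1" using r R by (auto simp: t_def field_simps)
        moreover have "(1 - t) *\<^sub>R (q - R *\<^sub>R f) + t *\<^sub>R (q + R *\<^sub>R f) = q + (2 * t * R - R) *\<^sub>R f"
          by (simp add: vec_eq_iff algebra_simps)
        moreover have "2 * t * R = r + R" using R by (simp add: t_def)
        then have "2 * t * R - R = r" by simp
        ultimately show ?thesis
          unfolding path_image_linepath in_segment x_eq by (intro exI[of _ t]) (simp add: add.commute)
      qed
    qed
  qed
qed

lemma lines_piecewise_smooth:
  assumes "bounded \<Omega>" and F: "finite F" "\<forall>(a, c)\<in>F. a \<noteq> 0"
    and "smooth_on (\<Omega> - (\<Union>(a, c)\<in>F. {x. a \<bullet> x = c})) u"
  shows "piecewise_smooth \<Omega> u"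
proof -
  obtain R where "\<forall>x\<in>\<Omega>. norm x \<le> R" using assms(1) unfolding bounded_iff ..
  then have R: "\<Omega> \<subseteq> cball 0 R" by auto
  have "\<forall>l\<in>F. \<exists>p. valid_path p \<and> {x. fst l \<bullet> x = snd l} \<inter> cball 0 R \<subseteq> path_image p"
  proof
    fix l assume "l \<in> F"
    then have "fst l \<noteq> 0" using F(2) by auto
    then obtain p where "valid_path p" "{x. fst l \<bullet> x = snd l} \<inter> cball 0 R \<subseteq> path_image p"
      by (rule line_Int_cball_subset_path)
    then show "\<exists>p. valid_path p \<and> {x. fst l \<bullet> x = snd l} \<inter> cball 0 R \<subseteq> path_image p" by blast
  qed
  from bchoice[OF this] obtain p
    where p: "\<forall>l\<in>F. valid_path (p l) \<and> {x. fst l \<bullet> x = snd l} \<inter> cball 0 R \<subseteq> path_image (p l)" ..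
  have sub: "\<Omega> - (\<Union>c\<in>p ` F. path_image c) \<subseteq> \<Omega> - (\<Union>(a, c)\<in>F. {x. a \<bullet> x = c})"
  proof
    fix x assume x: "x \<in> \<Omega> - (\<Union>c\<in>p ` F. path_image c)"
    have "fst l \<bullet> x \<noteq> snd l" if l: "l \<in> F" for l
    proof
      assume "fst l \<bullet> x = snd l"
      then have "x \<in> {x. fst l \<bullet> x = snd l} \<inter> cball 0 R" using x R by blast
      then have "x \<in> path_image (p l)" using bspec[OF p l] by blast
      then show False using x l by blast
    qed
    then show "x \<in> \<Omega> - (\<Union>(a, c)\<in>F. {x. a \<bullet> x = c})" using x by force
  qed
  have mono: "Ck_on k T u \<Longrightarrow> S \<subseteq> T \<Longrightarrow> Ck_on k S u" for k S T and u :: "real^2 \<Rightarrow> real"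
  proof (induction k arbitrary: u)
    case (Suc k)
    then obtain g where g: "\<forall>x\<in>T. GDERIV u x :> g x" "\<forall>i. Ck_on k T (\<lambda>x. g x $ i)" by auto
    have "\<forall>x\<in>S. GDERIV u x :> g x" using g(1) Suc.prems(2) by blast
    moreover have "\<forall>i. Ck_on k S (\<lambda>x. g x $ i)" using g(2) Suc.IH Suc.prems(2) by simp
    ultimately show ?case unfolding Ck_on.simps by (intro exI conjI)
  qed (auto intro: continuous_on_subset)
  show ?thesis
    unfolding piecewise_smooth_def
  proof (intro exI conjI)
    show "finite (p ` F)" "\<forall>c\<in>p ` F. valid_path c" using F p by auto
    show "smooth_on (\<Omega> - (\<Union>c\<in>p ` F. path_image c)) u"
      using assms(4) mono[OF _ sub] by (simp add: smooth_on_def)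
  qed
qed

text \<open>The function is affine on the cells and 0 elsewhere. At a regular point outside all
  cells it attains its minimum, so the gradient vanishes and the condition is trivial; only rays
  that start in cells matter. The hypothesis \<open>low\<close> deals with those ending where u = 0,
  and \<open>hit\<close> with those ending in a cell.\<close>

lemma piecewise_affine_admissible:
  fixes Q :: "'i \<Rightarrow> (real^2) set" and v :: "'i \<Rightarrow> real^2" and c :: "'i \<Rightarrow> real"
  assumes \<Omega>: "open \<Omega>" "bounded \<Omega>" and M: "0 \<le> M" and I: "finite I"
    and Q: "\<And>i. i \<in> I \<Longrightarrow> open (Q i)" "\<And>i. i \<in> I \<Longrightarrow> polygonal (Q i)"
    and disj: "\<And>i j x. i \<in> I \<Longrightarrow> j \<in> I \<Longrightarrow> x \<in> Q i \<Longrightarrow> x \<in> Q j \<Longrightarrow> i = j"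
    and rng: "\<And>i x. i \<in> I \<Longrightarrow> x \<in> Q i \<Longrightarrow> 0 \<le> v i \<bullet> x + c i \<and> v i \<bullet> x + c i \<le> M"
    and low: "\<And>i x t. i \<in> I \<Longrightarrow> x \<in> Q i \<Longrightarrow> t > 0 \<Longrightarrow> x - t *\<^sub>R v i \<in> closure \<Omega> \<Longrightarrow>
        0 \<le> v i \<bullet> x + c i + t * (1/2 * (1 - (norm (v i))\<^sup>2))"
    and hit: "\<And>i j x t. i \<in> I \<Longrightarrow> x \<in> Q i \<Longrightarrow> t > 0 \<Longrightarrow> x - t *\<^sub>R v i \<in> closure \<Omega> \<Longrightarrow> j \<in> I \<Longrightarrow>
        x - t *\<^sub>R v i \<in> Q j \<Longrightarrow>
        v j \<bullet> (x - t *\<^sub>R v i) + c j \<le> v i \<bullet> x + c i + t * (1/2 * (1 - (norm (v i))\<^sup>2))"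
  obtains u where "u \<in> admissible \<Omega> M" "\<And>i x. i \<in> I \<Longrightarrow> x \<in> Q i \<Longrightarrow> grad u x = v i"
proof -
  define u where "u x = (\<Sum>i\<in>I. if x \<in> Q i then v i \<bullet> x + c i else 0)" for x
  have u_in: "u x = v i \<bullet> x + c i" if "i \<in> I" "x \<in> Q i" for i x
  proof -
    have "u x = (\<Sum>j\<in>I. if j = i then v i \<bullet> x + c i else 0)"
      unfolding u_def using disj that by (intro sum.cong) auto
    then show ?thesis using that I by simp
  qed
  have u_out: "u x = 0" if "\<And>i. i \<in> I \<Longrightarrow> x \<notin> Q i" for x
    unfolding u_def using that by (intro sum.neutral) auto
  have u_rng: "0 \<le> u x \<and> u x \<le> M" for x
  proof (cases "\<exists>i\<in>I. x \<in> Q i")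
    case True
    then show ?thesis using u_in rng by fastforce
  next
    case False
    then have "u x = 0" by (intro u_out) blast
    then show ?thesis using M by simp
  qed
  have grad_in: "GDERIV u x :> v i" if "i \<in> I" "x \<in> Q i" for i x
    using Q(1) that u_in by (intro locally_affine_GDERIV[of "Q i"]) auto
  have "\<forall>i\<in>I. \<exists>F. finite F \<and> (\<forall>(a, c)\<in>F. a \<noteq> 0) \<and> frontier (Q i) \<subseteq> (\<Union>(a, c)\<in>F. {x. a \<bullet> x = c})"
    using Q(2) by (simp add: polygonal_def)
  from bchoice[OF this] obtain F where F0: "\<forall>i\<in>I. finite (F i) \<and> (\<forall>(a, c)\<in>F i. a \<noteq> 0) \<and>
      frontier (Q i) \<subseteq> (\<Union>(a, c)\<in>F i. {x. a \<bullet> x = c})" ..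
  have F: "finite (F i)" "\<forall>(a, c)\<in>F i. a \<noteq> 0" "frontier (Q i) \<subseteq> (\<Union>(a, c)\<in>F i. {x. a \<bullet> x = c})"
    if "i \<in> I" for i
    using bspec[OF F0 that] by simp_all
  define G where "G = (\<Union>i\<in>I. F i)"
  have ps: "piecewise_smooth \<Omega> u"
  proof (rule lines_piecewise_smooth[OF \<Omega>(2)])
    show "finite G" "\<forall>(a, c)\<in>G. a \<noteq> 0" using F I by (auto simp: G_def)
    have "\<exists>U v c. open U \<and> x \<in> U \<and> (\<forall>y\<in>U. u y = v \<bullet> y + c)"
      if x: "x \<in> \<Omega> - (\<Union>(a, c)\<in>G. {x. a \<bullet> x = c})" for x
    proof (cases "\<exists>i\<in>I. x \<in> Q i")
      case True
      then obtain i where i: "i \<in> I" "x \<in> Q i" by blast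
      show ?thesis
        by (rule exI[of _ "Q i"], rule exI[of _ "v i"], rule exI[of _ "c i"]) (use Q(1) u_in i in auto)
    next
      case False
      \<comment> \<open>Off the lines a point that is outside a cell is also outside its closure, so
        u vanishes in a whole neighbourhood of x.\<close>
      have "x \<notin> closure (Q i)" if i: "i \<in> I" for i
      proof
        assume "x \<in> closure (Q i)"
        then have "x \<in> frontier (Q i)" using False i Q(1) by (simp add: frontier_def interior_open)
        then have "x \<in> (\<Union>(a, c)\<in>F i. {x. a \<bullet> x = c})" using F(3)[OF i] by blast
        then have "x \<in> (\<Union>(a, c)\<in>G. {x. a \<bullet> x = c})" using i unfolding G_def by blast
        then show False using x by blast
      qed
      then have "x \<in> - (\<Union>i\<in>I. closure (Q i))" by auto
      moreover have "open (- (\<Union>i\<in>I. closure (Q i)))"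
        using I by (auto intro: closed_UN)
      moreover have "u y = 0 \<bullet> y + 0" if y: "y \<in> - (\<Union>i\<in>I. closure (Q i))" for y
      proof -
        have "y \<notin> Q i" if "i \<in> I" for i using y that closure_subset[of "Q i"] by blast
        then have "u y = 0" by (rule u_out)
        then show ?thesis by simp
      qed
      ultimately show ?thesis
        by (intro exI[of _ "- (\<Union>i\<in>I. closure (Q i))"] exI[of _ 0] conjI ballI)
    qed
    then show "smooth_on (\<Omega> - (\<Union>(a, c)\<in>G. {x. a \<bullet> x = c})) u"
      unfolding smooth_on_def by (intro allI locally_affine_Ck_on)
  qed
  have sic: "(u (x - t *\<^sub>R grad u x) - u x) / t \<le> 1/2 * (1 - (norm (grad u x))\<^sup>2)"
    if reg: "regular_point \<Omega> u x" and t: "t > 0" and y: "x - t *\<^sub>R grad u x \<in> closure \<Omega>" for x t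
  proof (cases "\<exists>i\<in>I. x \<in> Q i")
    case True
    then obtain i where i: "i \<in> I" "x \<in> Q i" by blast
    have g: "grad u x = v i" using grad_in[OF i] by (rule grad_eq)
    have "u (x - t *\<^sub>R v i) \<le> v i \<bullet> x + c i + t * (1/2 * (1 - (norm (v i))\<^sup>2))"
    proof (cases "\<exists>j\<in>I. x - t *\<^sub>R v i \<in> Q j")
      case True
      then show ?thesis using hit[OF i t] y u_in unfolding g by auto
    next
      case False
      then have "u (x - t *\<^sub>R v i) = 0" by (intro u_out) auto
      then show ?thesis using low[OF i t] y unfolding g by simp
    qed
    then show ?thesis
      unfolding g u_in[OF i] using t by (simp add: field_simps)
  next
    case False
    have u0: "u x = 0" using False by (intro u_out) auto
    obtain U where U: "open U" "x \<in> U" "smooth_on U u"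
      using reg unfolding regular_point_def by blast
    have "(u has_derivative (\<lambda>h. h \<bullet> grad u x)) (at x)"
      using smooth_on_GDERIV(1)[OF U(3,2)] by (simp add: gderiv_def)
    then have "(\<lambda>h. h \<bullet> grad u x) = (\<lambda>h. 0)"
      using u_rng u0 by (intro differential_zero_maxmin[of x UNIV u]) auto
    then have "grad u x = 0" by (metis inner_eq_zero_iff)
    then show ?thesis by simp
  qed
  show thesis
  proof (rule that)
    show "u \<in> admissible \<Omega> M"
      using ps sic u_rng by (auto simp: admissible_def SIC_def)
    show "grad u x = v i" if "i \<in> I" "x \<in> Q i" for i x
      using grad_in[OF that] by (rule grad_eq)
  qed
qed

section \<open>Packing and perturbation estimates\<close>

text \<open>The resistance density never exceeds 1 and the optimal density is nonnegative, so a bad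
  set B costs at most its area.\<close>

lemma resistance_le:
  assumes \<Omega>: "open \<Omega>" "bounded \<Omega>" and M: "0 < M" and u: "u \<in> admissible \<Omega> M"
    and B: "B \<in> lmeasurable" "measure lebesgue B \<le> b" and Z: "negligible Z" and \<kappa>: "0 \<le> \<kappa>"
    and le: "\<And>x. x \<in> \<Omega> - B - Z \<Longrightarrow>
        1 / (1 + (norm (grad u x))\<^sup>2) \<le> optimal_density M (infdist x (frontier \<Omega>)) + \<kappa>"
  shows "resistance \<Omega> u \<le> phi \<Omega> M + \<kappa> * measure lebesgue \<Omega> + b"
proof -
  let ?o = "\<lambda>x. optimal_density M (infdist x (frontier \<Omega>))"
  have ps: "piecewise_smooth \<Omega> u" using u by (simp add: admissible_def SIC_def)
  have \<Omega>l: "\<Omega> \<in> lmeasurable" using \<Omega> lmeasurable_open by blast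
  have B\<Omega>: "B \<inter> \<Omega> \<in> lmeasurable" using B \<Omega>l by (intro fmeasurable.Int) auto
  have i1: "set_integrable lebesgue \<Omega> ?o" by (rule optimal_density_integrable[OF \<Omega> M])
  have i2: "set_integrable lebesgue \<Omega> (\<lambda>x. \<kappa>)"
    using \<Omega>l by (auto simp: set_integrable_def fmeasurable_def)
  have i3: "set_integrable lebesgue \<Omega> (indicator B :: _ \<Rightarrow> real)"
    using B\<Omega> by (auto simp: set_integrable_def fmeasurable_def indicator_inter_arith[symmetric] Int_commute)
  have "resistance \<Omega> u \<le> (LINT x:\<Omega>|lebesgue. ?o x + (\<kappa> + indicator B x))"
    unfolding resistance_def
  proof (rule set_lebesgue_integral_mono_negligible[OF resistance_integrable[OF \<Omega> ps] _ Z])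
    show "set_integrable lebesgue \<Omega> (\<lambda>x. ?o x + (\<kappa> + indicator B x))"
      by (intro set_integral_add(1) i1 i2 i3)
    fix x assume x: "x \<in> \<Omega> - Z"
    have "1 / (1 + (norm (grad u x))\<^sup>2) \<le> 1" by (simp add: divide_le_eq_1 add_pos_nonneg)
    then show "1 / (1 + (norm (grad u x))\<^sup>2) \<le> ?o x + (\<kappa> + indicator B x)"
      using le[of x] x \<kappa> optimal_density_bounds(1)[OF M, of "infdist x (frontier \<Omega>)"]
      by (cases "x \<in> B") auto
  qed
  also have "\<dots> = phi \<Omega> M + ((LINT x:\<Omega>|lebesgue. \<kappa>) + (LINT x:\<Omega>|lebesgue. indicator B x))"
    unfolding phi_eq by (simp add: set_integral_add i1 i2 i3)
  also have "(LINT x:\<Omega>|lebesgue. \<kappa>) = \<kappa> * measure lebesgue \<Omega>"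
    using \<Omega>l by (simp add: set_lebesgue_integral_def fmeasurable_def)
  also have "(LINT x:\<Omega>|lebesgue. indicator B x :: real) = measure lebesgue (B \<inter> \<Omega>)"
    using B\<Omega> by (simp add: set_lebesgue_integral_def indicator_inter_arith[symmetric] Int_commute)
  also have "measure lebesgue (B \<inter> \<Omega>) \<le> b"
    using measure_mono_fmeasurable[of "B \<inter> \<Omega>" B lebesgue] B B\<Omega> by (simp add: fmeasurableD)
  finally show ?thesis by simp
qed

text \<open>Used to turn boxes with disjoint interiors into disjoint compact ones. Cutting the
  proportion \<theta> of the side length off at each of the four sides loses at most 4 \<theta> of
  the area.\<close>

lemma cbox_shrink:
  fixes c d :: "real^2"
  assumes ne: "box c d \<noteq> {}" and \<eta>: "0 < \<eta>"
  obtains c' d' where "cbox c' d' \<subseteq> box c d" "measure lebesgue (cbox c d - cbox c' d') \<le> \<eta>"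
proof -
  have cd: "c$1 < d$1" "c$2 < d$2"
    using ne by (auto simp: interval_ne_empty_cart forall_2)
  define m where "m = (d$1 - c$1) * (d$2 - c$2)"
  have m: "0 < m" using cd by (simp add: m_def)
  define \<theta> where "\<theta> = min (1/4) (\<eta> / (4 * m))"
  have \<theta>: "0 < \<theta>" "\<theta> \<le> 1/4" "4 * \<theta> * m \<le> \<eta>"
  proof -
    show "0 < \<theta>" "\<theta> \<le> 1/4" using m \<eta> by (auto simp: \<theta>_def)
    have "\<theta> \<le> \<eta> / (4 * m)" by (simp add: \<theta>_def)
    then show "4 * \<theta> * m \<le> \<eta>" using m by (simp add: field_simps)
  qed
  define c' d' :: "real^2" where "c' = vector [c$1 + \<theta> * (d$1 - c$1), c$2 + \<theta> * (d$2 - c$2)]"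
    and "d' = vector [d$1 - \<theta> * (d$1 - c$1), d$2 - \<theta> * (d$2 - c$2)]"
  have half: "2 * (\<theta> * (d$i - c$i)) \<le> d$i - c$i" if "c$i < d$i" for i
    using \<theta> that mult_right_mono[of "2 * \<theta>" 1 "d$i - c$i"] by simp
  have pos: "0 < \<theta> * (d$1 - c$1)" "0 < \<theta> * (d$2 - c$2)" using \<theta> cd by auto
  have sub: "cbox c' d' \<subseteq> box c d"
    using pos by (auto simp: mem_box_cart forall_2 c'_def d'_def)
  have "cbox c d \<noteq> {}" using cd by (auto simp: interval_ne_empty_cart forall_2)
  moreover have "cbox c' d' \<noteq> {}"
    unfolding interval_ne_empty_cart forall_2 c'_def d'_def vector_2
    using half[OF cd(1)] half[OF cd(2)] by linarith
  ultimately have ne': "cbox c d \<noteq> {}" "cbox c' d' \<noteq> {}" by auto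
  have m1: "measure lebesgue (cbox c d) = m"
    using ne' by (simp add: content_cbox_cart UNIV_2 m_def)
  have "measure lebesgue (cbox c' d') =
      ((d$1 - c$1) - 2 * (\<theta> * (d$1 - c$1))) * ((d$2 - c$2) - 2 * (\<theta> * (d$2 - c$2)))"
    using ne' by (simp add: content_cbox_cart UNIV_2 c'_def d'_def algebra_simps)
  also have "\<dots> = (1 - 2 * \<theta>)\<^sup>2 * m"
    by (simp add: m_def power2_eq_square algebra_simps)
  finally have m2: "measure lebesgue (cbox c' d') = (1 - 2 * \<theta>)\<^sup>2 * m" .
  have "cbox c' d' \<subseteq> cbox c d" using sub box_subset_cbox by blast
  then have "measure lebesgue (cbox c d - cbox c' d') = m - (1 - 2 * \<theta>)\<^sup>2 * m"
    using m1 m2 by (subst measurable_measure_Diff) auto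
  also have "\<dots> = 4 * \<theta> * m - 4 * \<theta>\<^sup>2 * m" by (simp add: power2_eq_square algebra_simps)
  also have "\<dots> \<le> \<eta>" using \<theta> m by (smt (verit) mult_nonneg_nonneg zero_le_power2)
  finally show thesis using that sub by blast
qed

text \<open>A gauge forces the boxes of the covering lemma to be small and to stay inside
  \<open>\<Omega>\<close>. Finitely many of these countably many boxes carry almost all of the area,
  and shrinking these finitely many makes them disjoint.\<close>

lemma box_packing:
  fixes \<Omega> :: "(real^2) set"
  assumes \<Omega>: "open \<Omega>" "bounded \<Omega>" and \<delta>: "0 < \<delta>" and \<eta>: "0 < \<eta>"
  obtains \<K> where "finite \<K>" "\<And>K. K \<in> \<K> \<Longrightarrow> \<exists>c d. K = cbox c d"
    "\<And>K L. K \<in> \<K> \<Longrightarrow> L \<in> \<K> \<Longrightarrow> K \<noteq> L \<Longrightarrow> K \<inter> L = {}"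
    "\<And>K. K \<in> \<K> \<Longrightarrow> \<exists>x\<in>\<Omega>. K \<subseteq> ball x \<delta> \<inter> \<Omega>"
    "measure lebesgue (\<Omega> - \<Union>\<K>) \<le> \<eta>"
proof (cases "\<Omega> = {}")
  case True
  then show thesis using that[of "{}"] \<eta> by auto
next
  case False
  obtain a where a: "\<Omega> \<subseteq> box (- a) a" using bounded_subset_box_symmetric[OF \<Omega>(2)] .
  then have a1: "\<Omega> \<subseteq> cbox (- a) a" using box_subset_cbox by blast
  have a2: "box (- a) a \<noteq> {}" using a False by blast
  \<comment> \<open>The value off \<open>\<Omega>\<close> is a filler that makes g a gauge
    everywhere; the tags supplied by the covering lemma lie in \<open>\<Omega>\<close>.\<close>
  define g where "g x = (if x \<in> \<Omega> then ball x \<delta> \<inter> \<Omega> else ball x 1)" for x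
  have g: "gauge g" using \<Omega> \<delta> by (auto simp: gauge_def g_def)
  obtain \<D> where \<D>: "countable \<D>"
    "\<And>K. K \<in> \<D> \<Longrightarrow> interior K \<noteq> {} \<and> (\<exists>c d. K = cbox c d)"
    "pairwise (\<lambda>A B. interior A \<inter> interior B = {}) \<D>"
    "\<And>K. K \<in> \<D> \<Longrightarrow> \<exists>x \<in> \<Omega> \<inter> K. K \<subseteq> g x"
    "\<Omega> \<subseteq> \<Union>\<D>"
    using covering_lemma[OF a1 a2 g] by metis
  have in\<Omega>: "\<exists>x\<in>\<Omega>. K \<subseteq> ball x \<delta> \<inter> \<Omega>" if "K \<in> \<D>" for K
    using \<D>(4)[OF that] unfolding g_def by auto
  have eq: "\<Union>\<D> = \<Omega>" using \<D>(5) in\<Omega> by blast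
  have \<Omega>l: "\<Omega> \<in> lmeasurable" using \<Omega> lmeasurable_open by blast
  have \<D>l: "K \<in> lmeasurable" if "K \<in> \<D>" for K using \<D>(2)[OF that] by auto
  have bound: "measure lebesgue (\<Union>\<D>') \<le> measure lebesgue \<Omega>" if "\<D>' \<subseteq> \<D>" "finite \<D>'" for \<D>'
  proof (rule measure_mono_fmeasurable[OF _ _ \<Omega>l])
    show "\<Union>\<D>' \<subseteq> \<Omega>" using that eq by blast
    show "\<Union>\<D>' \<in> sets lebesgue" using that \<D>l by (intro sets.finite_Union) (auto simp: fmeasurableD)
  qed
  have "0 < \<eta> / 2" using \<eta> by simp
  then obtain \<D>' where \<D>': "\<D>' \<subseteq> \<D>" "finite \<D>'" "measure lebesgue (\<Union>\<D>) - \<eta> / 2 < measure lebesgue (\<Union>\<D>')"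
    using measure_countable_Union_approachable[OF \<D>(1) _ \<D>l bound] by blast
  define \<eta>' where "\<eta>' = \<eta> / (2 * (real (card \<D>') + 1))"
  have \<eta>': "0 < \<eta>'" using \<eta> by (simp add: \<eta>'_def)
  have "\<forall>K\<in>\<D>'. \<exists>K'. (\<exists>c d. K' = cbox c d) \<and> K' \<subseteq> interior K \<and> measure lebesgue (K - K') \<le> \<eta>'"
  proof
    fix K assume "K \<in> \<D>'"
    then obtain c d where K: "K = cbox c d" "box c d \<noteq> {}"
      using \<D>' \<D>(2) by (metis interior_cbox subsetD)
    obtain c' d' where "cbox c' d' \<subseteq> box c d" "measure lebesgue (cbox c d - cbox c' d') \<le> \<eta>'"
      using cbox_shrink[OF K(2) \<eta>'] .
    then show "\<exists>K'. (\<exists>c d. K' = cbox c d) \<and> K' \<subseteq> interior K \<and> measure lebesgue (K - K') \<le> \<eta>'"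
      unfolding K by (intro exI[of _ "cbox c' d'"]) (auto simp: interior_cbox)
  qed
  from bchoice[OF this] obtain sh
    where sh0: "\<forall>K\<in>\<D>'. (\<exists>c d. sh K = cbox c d) \<and> sh K \<subseteq> interior K \<and> measure lebesgue (K - sh K) \<le> \<eta>'" ..
  have sh: "\<exists>c d. sh K = cbox c d" "sh K \<subseteq> interior K" "measure lebesgue (K - sh K) \<le> \<eta>'"
    if "K \<in> \<D>'" for K using bspec[OF sh0 that] by auto
  show thesis
  proof (rule that[of "sh ` \<D>'"])
    show "finite (sh ` \<D>')" using \<D>' by simp
    show "\<exists>c d. K = cbox c d" if "K \<in> sh ` \<D>'" for K using that sh(1) by blast
    show "K \<inter> L = {}" if KL: "K \<in> sh ` \<D>'" "L \<in> sh ` \<D>'" "K \<noteq> L" for K L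
    proof -
      obtain K0 L0 where 0: "K0 \<in> \<D>'" "L0 \<in> \<D>'" "K = sh K0" "L = sh L0" using KL by blast
      then have "K0 \<noteq> L0" using KL by blast
      then have "interior K0 \<inter> interior L0 = {}"
        using \<D>(3) \<D>'(1) 0 unfolding pairwise_def by blast
      then show ?thesis using sh(2)[OF 0(1)] sh(2)[OF 0(2)] 0(3,4) by blast
    qed
    show "\<exists>x\<in>\<Omega>. K \<subseteq> ball x \<delta> \<inter> \<Omega>" if K: "K \<in> sh ` \<D>'" for K
    proof -
      obtain K0 where 0: "K0 \<in> \<D>'" "K = sh K0" using K by blast
      then have "K \<subseteq> K0" using sh(2)[OF 0(1)] interior_subset by blast
      moreover obtain x where "x \<in> \<Omega>" "K0 \<subseteq> ball x \<delta> \<inter> \<Omega>" using in\<Omega> 0(1) \<D>'(1) by blast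
      ultimately show ?thesis by blast
    qed
    have l: "K - sh K \<in> lmeasurable" if "K \<in> \<D>'" for K
    proof -
      have "K \<in> lmeasurable" using that \<D>'(1) \<D>l by blast
      moreover have "sh K \<in> sets lebesgue" using sh(1)[OF that] by auto
      ultimately show ?thesis by (rule fmeasurable_Diff)
    qed
    have U: "\<Union>\<D>' \<in> lmeasurable" "\<Union>\<D>' \<subseteq> \<Omega>"
      using \<D>' \<D>l eq by (auto intro!: fmeasurable.finite_Union)
    have m1: "measure lebesgue (\<Omega> - \<Union>\<D>') \<le> \<eta> / 2"
      using \<D>'(3) measurable_measure_Diff[OF \<Omega>l _ U(2)] U eq by (simp add: fmeasurableD)
    have m2: "(\<Union>K\<in>\<D>'. K - sh K) \<in> lmeasurable"
      "measure lebesgue (\<Union>K\<in>\<D>'. K - sh K) \<le> real (card \<D>') * \<eta>'"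
      using measure_finite_UN_le_card[of \<D>' "\<lambda>K. K - sh K" \<eta>'] \<D>'(2) l sh(3) by auto
    have "real (card \<D>') * \<eta>' \<le> \<eta> / 2" using \<eta> by (simp add: \<eta>'_def field_simps)
    moreover have "measure lebesgue (\<Omega> - \<Union>(sh ` \<D>')) \<le> measure lebesgue ((\<Omega> - \<Union>\<D>') \<union> (\<Union>K\<in>\<D>'. K - sh K))"
    proof (rule measure_mono_fmeasurable)
      show "\<Omega> - \<Union>(sh ` \<D>') \<subseteq> (\<Omega> - \<Union>\<D>') \<union> (\<Union>K\<in>\<D>'. K - sh K)" by blast
      have "sh K \<in> sets lebesgue" if "K \<in> \<D>'" for K using sh(1)[OF that] by auto
      then have "\<Union>(sh ` \<D>') \<in> sets lebesgue" using \<D>'(2) by (intro sets.finite_Union) auto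
      then show "\<Omega> - \<Union>(sh ` \<D>') \<in> sets lebesgue" using \<Omega>l by (intro sets.Diff) (auto simp: fmeasurableD)
      show "(\<Omega> - \<Union>\<D>') \<union> (\<Union>K\<in>\<D>'. K - sh K) \<in> lmeasurable"
        using m2(1) U \<Omega>l by (intro fmeasurable.Un fmeasurable_Diff) (auto simp: fmeasurableD)
    qed
    moreover have "measure lebesgue ((\<Omega> - \<Union>\<D>') \<union> (\<Union>K\<in>\<D>'. K - sh K))
        \<le> measure lebesgue (\<Omega> - \<Union>\<D>') + measure lebesgue (\<Union>K\<in>\<D>'. K - sh K)"
      using m2(1) U \<Omega>l by (intro measure_Un_le sets.Diff) (auto simp: fmeasurableD)
    ultimately show "measure lebesgue (\<Omega> - \<Union>(sh ` \<D>')) \<le> \<eta>"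
      using m1 m2(2) by linarith
  qed
qed

lemma disjoint_compact_family_separated:
  fixes \<K> :: "'a::heine_borel set set"
  assumes fin: "finite \<K>" and comp: "\<And>K. K \<in> \<K> \<Longrightarrow> compact K"
    and disj: "\<And>K L. K \<in> \<K> \<Longrightarrow> L \<in> \<K> \<Longrightarrow> K \<noteq> L \<Longrightarrow> K \<inter> L = {}"
  obtains s :: real where "0 < s"
    "\<And>K L x y. K \<in> \<K> \<Longrightarrow> L \<in> \<K> \<Longrightarrow> x \<in> K \<Longrightarrow> y \<in> L \<Longrightarrow> dist x y < s \<Longrightarrow> K = L"
proof -
  define P where "P = {(K, L) \<in> \<K> \<times> \<K>. K \<noteq> L}"
  have P: "finite P" unfolding P_def by (rule finite_subset[of _ "\<K> \<times> \<K>"]) (use fin in auto)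
  have "\<forall>p\<in>P. \<exists>s>0. \<forall>x\<in>fst p. \<forall>y\<in>snd p. s \<le> dist x y"
  proof
    fix p assume "p \<in> P"
    then obtain K L where p: "p = (K, L)" "K \<in> \<K>" "L \<in> \<K>" "K \<noteq> L" by (auto simp: P_def)
    then have "\<exists>s>0. \<forall>x\<in>K. \<forall>y\<in>L. s \<le> dist x y"
      by (intro separate_compact_closed) (auto simp: comp compact_imp_closed disj)
    then show "\<exists>s>0. \<forall>x\<in>fst p. \<forall>y\<in>snd p. s \<le> dist x y" by (simp add: p)
  qed
  from bchoice[OF this] obtain s where s: "\<forall>p\<in>P. 0 < s p \<and> (\<forall>x\<in>fst p. \<forall>y\<in>snd p. s p \<le> dist x y)" ..
  \<comment> \<open>The inserted 1 gives the minimum a meaning when there is no pair of distinct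
    members.\<close>
  define s0 where "s0 = Min (insert 1 (s ` P))"
  show thesis
  proof (rule that[of s0])
    show "0 < s0" using P s by (auto simp: s0_def)
    fix K L x y assume H: "K \<in> \<K>" "L \<in> \<K>" "x \<in> K" "y \<in> L" "dist x y < s0"
    show "K = L"
    proof (rule ccontr)
      assume "K \<noteq> L"
      then have KL: "(K, L) \<in> P" using H by (simp add: P_def)
      then have "s0 \<le> s (K, L)" using P by (simp add: s0_def)
      also have "\<dots> \<le> dist x y" using bspec[OF s KL] H by simp
      finally show False using H by simp
    qed
  qed
qed

text \<open>This is where convexity enters: the supporting line at a nearest frontier point p has
  unit normal e and keeps the whole closure behind p. What is bounded is progress along e only, so
  the estimate also serves rays that are tilted against e.\<close>

lemma exit_direction:
  fixes \<Omega> :: "(real^2) set"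
  assumes \<Omega>: "convex \<Omega>" "open \<Omega>" "bounded \<Omega>" and x: "x \<in> \<Omega>"
  obtains e where "norm e = 1" "\<And>y. y \<in> closure \<Omega> \<Longrightarrow> (y - x) \<bullet> e \<le> infdist x (frontier \<Omega>)"
proof -
  have "frontier \<Omega> \<noteq> {}" using infdist_frontier_pos[OF \<Omega>(2,3) x] by simp
  then obtain p where p: "p \<in> frontier \<Omega>" "infdist x (frontier \<Omega>) = dist x p"
    using infdist_attains_inf[OF frontier_closed] by metis
  have "p \<notin> \<Omega>" using p \<Omega>(2) frontier_disjoint_eq by blast
  then obtain a b where a: "a \<noteq> 0" "\<forall>y\<in>\<Omega>. a \<bullet> y \<le> b" "b \<le> a \<bullet> p"
    using separating_hyperplane_sets[of \<Omega> "{p}"] \<Omega>(1) x by auto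
  have "closure \<Omega> \<subseteq> {y. a \<bullet> y \<le> b}"
    using a by (intro closure_minimal closed_halfspace_le) auto
  then have cl: "a \<bullet> y \<le> a \<bullet> p" if "y \<in> closure \<Omega>" for y using that a(3) by fastforce
  define e where "e = a /\<^sub>R norm a"
  show thesis
  proof (rule that[of e])
    show e: "norm e = 1" using a by (simp add: e_def)
    fix y assume "y \<in> closure \<Omega>"
    then have "(y - x) \<bullet> e \<le> (p - x) \<bullet> e"
      using cl[of y] a(1) by (simp add: e_def inner_diff_left inner_diff_right inner_commute mult_left_mono)
    also have "\<dots> \<le> norm (p - x) * norm e" by (rule norm_cauchy_schwarz)
    also have "\<dots> = infdist x (frontier \<Omega>)" using p e by (simp add: dist_norm norm_minus_commute)
    finally show "(y - x) \<bullet> e \<le> infdist x (frontier \<Omega>)" .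
  qed
qed

section \<open>Dependence of the optimal density on height and distance\<close>

lemma inverse_sqrt_Lipschitz:
  assumes "0 \<le> q" "q \<le> p"
  shows "1 / sqrt (1 + q\<^sup>2) - 1 / sqrt (1 + p\<^sup>2) \<le> p - q"
proof -
  define s t where "s = sqrt (1 + q\<^sup>2)" and "t = sqrt (1 + p\<^sup>2)"
  have s: "1 \<le> s" "s\<^sup>2 = 1 + q\<^sup>2" "q \<le> s"
    using assms by (auto simp: s_def real_le_rsqrt)
  have t: "1 \<le> t" "t\<^sup>2 = 1 + p\<^sup>2" "p \<le> t"
    using assms by (auto simp: t_def real_le_rsqrt)
  have st: "s \<le> t" using assms by (auto simp: s_def t_def power_mono)
  have "(t - s) * (t + s) = (p - q) * (p + q)"
    using s t by (simp add: power2_eq_square algebra_simps)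
  also have "\<dots> \<le> (p - q) * (t + s)"
    using assms s t by (intro mult_left_mono) auto
  finally have "t - s \<le> p - q" using s t by simp
  moreover have "1 / s - 1 / t = (t - s) / (s * t)" using s t by (simp add: field_simps)
  moreover have "(t - s) / (s * t) \<le> (t - s) / 1"
    using s t st mult_mono[of 1 s 1 t] by (intro divide_left_mono) auto
  ultimately show ?thesis unfolding s_def t_def by simp
qed

text \<open>The density depends only on the ratio of distance and height, and it is Lipschitz in
  that ratio. The perturbation changes the ratio by at most \<delta> (2 M + d) / (M (M - \<delta>)),
  and M - \<delta> \<ge> M / 2 yields the constant.\<close>

lemma optimal_density_perturb:
  assumes M: "0 < M" and d: "0 \<le> d" "d \<le> D" "D \<le> d + 2 * \<delta>" "d \<le> B" and \<delta>: "0 < \<delta>" "\<delta> \<le> M / 2"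
  shows "optimal_density (M - \<delta>) D \<le> optimal_density M d + 2 * (2 * M + B) / M\<^sup>2 * \<delta>"
proof -
  have eq: "optimal_density m r = 1/2 * (1 - 1 / sqrt (1 + (r / m)\<^sup>2))" if "0 < m" for m r
  proof -
    have "sqrt (m\<^sup>2 + r\<^sup>2) = sqrt (m\<^sup>2 * (1 + (r / m)\<^sup>2))" using that by (simp add: field_simps)
    also have "\<dots> = m * sqrt (1 + (r / m)\<^sup>2)" using that by (simp add: real_sqrt_mult)
    finally show ?thesis using that by (simp add: optimal_density_def)
  qed
  have m: "0 < M - \<delta>" "M / 2 \<le> M - \<delta>" using \<delta> M by auto
  have "d / M \<le> D / (M - \<delta>)" using d m \<delta> M by (intro frac_le) auto
  then have "1 / sqrt (1 + (d / M)\<^sup>2) - 1 / sqrt (1 + (D / (M - \<delta>))\<^sup>2) \<le> D / (M - \<delta>) - d / M"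
    using d M by (intro inverse_sqrt_Lipschitz) auto
  also have "\<dots> \<le> (d + 2 * \<delta>) / (M - \<delta>) - d / M"
    using d m by (simp add: divide_right_mono)
  also have "\<dots> = \<delta> * (2 * M + d) / (M * (M - \<delta>))"
    using m M by (simp add: field_simps)
  also have "\<dots> \<le> \<delta> * (2 * M + B) / (M * (M / 2))"
    using m M d \<delta> by (intro frac_le mult_left_mono mult_nonneg_nonneg) auto
  also have "\<dots> = 2 * (2 * M + B) / M\<^sup>2 * \<delta>" by (simp add: power2_eq_square)
  finally have "1 / sqrt (1 + (d / M)\<^sup>2) - 1 / sqrt (1 + (D / (M - \<delta>))\<^sup>2) \<le> 2 * (2 * M + B) / M\<^sup>2 * \<delta>" .
  moreover have "0 \<le> 2 * (2 * M + B) / M\<^sup>2 * \<delta>" using M d \<delta> by auto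
  ultimately show ?thesis unfolding eq[OF m(1)] eq[OF M] by argo
qed

section \<open>Facets over strips\<close>

lemma polygonal_inner_halfspaces:
  fixes a :: "real^2"
  assumes "a \<noteq> 0"
  shows "polygonal {x. c \<le> x \<bullet> a}" "polygonal {x. x \<bullet> a < c}" "polygonal {x. x \<bullet> a \<le> c}"
  using polygonal_halfspace[OF assms] by (simp_all add: inner_commute)

lemma polygonal_strip:
  assumes ef: "orthonormal2 e f"
  shows "polygonal (strip e f w a c)"
proof -
  have "(f - a *\<^sub>R e) \<bullet> f = 1" using orthonormal2_inner[OF ef] by (simp add: inner_diff_left)
  then have ne: "f - a *\<^sub>R e \<noteq> 0" by force
  have "strip e f w a c = {x. c \<le> x \<bullet> (f - a *\<^sub>R e)} \<inter> {x. x \<bullet> (f - a *\<^sub>R e) < c + w}"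
    by (auto simp: strip_def inner_diff_right)
  then show ?thesis using polygonal_Int polygonal_inner_halfspaces[OF ne] by simp
qed

lemma polygonal_slab:
  assumes "norm e = 1"
  shows "polygonal {x. \<alpha> \<le> x \<bullet> e \<and> x \<bullet> e < \<beta>}"
proof -
  have "e \<noteq> 0" using assms by auto
  then have "polygonal ({x. \<alpha> \<le> x \<bullet> e} \<inter> {x. x \<bullet> e < \<beta>})"
    by (intro polygonal_Int polygonal_inner_halfspaces)
  then show ?thesis by (simp add: Collect_conj_eq)
qed

lemma polygonal_cbox: "polygonal (cbox c (d :: real^2))"
proof -
  have "cbox c d = ({x. c$1 \<le> x \<bullet> axis 1 1} \<inter> {x. x \<bullet> axis 1 1 \<le> d$1}) \<inter>
      ({x. c$2 \<le> x \<bullet> axis 2 1} \<inter> {x. x \<bullet> axis 2 1 \<le> d$2})"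
    by (auto simp: mem_box_cart forall_2 inner_axis)
  then show ?thesis
    by (simp only:) (intro polygonal_Int polygonal_inner_halfspaces; simp add: axis_eq_0_iff)
qed

text \<open>The gradient opposite to the strip direction e + a f, so that rays run along the strip,
  normalised so that the facet drops by exactly g for each unit gained along e.\<close>

definition facet_slope :: "real^2 \<Rightarrow> real^2 \<Rightarrow> real \<Rightarrow> real \<Rightarrow> real^2" where
  "facet_slope e f g a = - (g / (1 + a\<^sup>2)) *\<^sub>R (e + a *\<^sub>R f)"

lemma norm_facet_slope:
  assumes ef: "orthonormal2 e f"
  shows "(norm (facet_slope e f g a))\<^sup>2 = g\<^sup>2 / (1 + a\<^sup>2)"
proof -
  have a: "1 + a\<^sup>2 \<noteq> 0" by (smt (verit) zero_le_power2)
  have "(norm (e + a *\<^sub>R f))\<^sup>2 = 1 + a\<^sup>2"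
    using orthonormal2_inner[OF ef]
    unfolding power2_norm_eq_inner by (simp add: inner_add_left inner_add_right power2_eq_square)
  moreover have "norm (facet_slope e f g a) = \<bar>g / (1 + a\<^sup>2)\<bar> * norm (e + a *\<^sub>R f)"
    unfolding facet_slope_def norm_scaleR by simp
  ultimately have "(norm (facet_slope e f g a))\<^sup>2 = (g / (1 + a\<^sup>2))\<^sup>2 * (1 + a\<^sup>2)"
    by (simp only: power_mult_distrib power2_abs)
  also have "\<dots> = g\<^sup>2 / (1 + a\<^sup>2)" using a by (simp add: power2_eq_square)
  finally show ?thesis .
qed

text \<open>Separates progress along e from the coordinate across the strip, which is constant along
  a ray; across a strip of width w the second term varies by at most g * a * w when a \<ge> 0 and g
  \<ge> 0.\<close>

lemma facet_slope_inner:
  assumes ef: "orthonormal2 e f"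
  shows "facet_slope e f g a \<bullet> x = - g * (x \<bullet> e + a * (x \<bullet> f - a * (x \<bullet> e)) / (1 + a\<^sup>2))"
proof -
  have a: "1 + a\<^sup>2 \<noteq> 0" by (smt (verit) zero_le_power2)
  have "facet_slope e f g a \<bullet> x = - g * ((x \<bullet> e + a * (x \<bullet> f)) / (1 + a\<^sup>2))"
    unfolding facet_slope_def inner_scaleR_left inner_add_left
    by (simp add: inner_commute)
  also have "x \<bullet> e + a * (x \<bullet> f) = (x \<bullet> e) * (1 + a\<^sup>2) + a * (x \<bullet> f - a * (x \<bullet> e))"
    by (simp add: algebra_simps power2_eq_square)
  also have "((x \<bullet> e) * (1 + a\<^sup>2) + a * (x \<bullet> f - a * (x \<bullet> e))) / (1 + a\<^sup>2)
      = x \<bullet> e + a * (x \<bullet> f - a * (x \<bullet> e)) / (1 + a\<^sup>2)"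
    unfolding add_divide_distrib using a by simp
  finally show ?thesis .
qed

text \<open>A region r is the part \<open>Dm r\<close> of a box inside a slab of thickness h, and
  \<open>X r\<close> bounds the run from it to the exit. All facets lie between M - \<delta> and M,
  and the last hypothesis chooses the slope so that a particle reflected at height M - \<delta> is
  still nonnegative after that run. By \<open>sep\<close>, a cell met soon and inside the slab of r
  belongs to r itself; since the trenches are removed from all cells, no other collision can
  occur.\<close>

lemma facet_admissible_function:
  fixes Rg :: "'r set" and Dm :: "'r \<Rightarrow> (real^2) set" and e f :: "'r \<Rightarrow> real^2"
    and \<alpha> g w \<rho> X :: "'r \<Rightarrow> real" and N :: "'r \<Rightarrow> nat" and a c :: "'r \<Rightarrow> nat \<Rightarrow> real"
  assumes \<Omega>: "open \<Omega>" "bounded \<Omega>" and Rg: "finite Rg" and \<delta>: "0 \<le> \<delta>" "\<delta> \<le> M"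
    and ef: "\<And>r. r \<in> Rg \<Longrightarrow> orthonormal2 (e r) (f r)"
    and Dm: "\<And>r. r \<in> Rg \<Longrightarrow> polygonal (Dm r)"
      "\<And>r x. r \<in> Rg \<Longrightarrow> x \<in> Dm r \<Longrightarrow> \<alpha> r \<le> x \<bullet> e r \<and> x \<bullet> e r < \<alpha> r + h"
    and sep: "\<And>r r' x y. r \<in> Rg \<Longrightarrow> r' \<in> Rg \<Longrightarrow> x \<in> Dm r \<Longrightarrow> y \<in> Dm r' \<Longrightarrow>
        norm (y - x) < 2 * h \<Longrightarrow> \<alpha> r \<le> y \<bullet> e r \<Longrightarrow> y \<bullet> e r < \<alpha> r + h \<Longrightarrow> r = r'"
    and w: "\<And>r. r \<in> Rg \<Longrightarrow> 0 < w r" and \<rho>: "\<And>r. r \<in> Rg \<Longrightarrow> 0 \<le> \<rho> r \<and> \<rho> r \<le> 1"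
    and a: "\<And>r i. r \<in> Rg \<Longrightarrow> 0 \<le> a r i \<and> a r i \<le> \<rho> r"
    and g: "\<And>r. r \<in> Rg \<Longrightarrow> 1 \<le> g r" "\<And>r. r \<in> Rg \<Longrightarrow> g r * (h + \<rho> r * w r * real (N r)) \<le> \<delta>"
    and exit: "\<And>r x y. r \<in> Rg \<Longrightarrow> x \<in> Dm r \<Longrightarrow> y \<in> closure \<Omega> \<Longrightarrow> y \<bullet> e r - x \<bullet> e r \<le> X r"
      "\<And>r. r \<in> Rg \<Longrightarrow> ((g r)\<^sup>2 - 1) * X r \<le> 2 * (M - \<delta>) * g r"
  obtains u Z where "u \<in> admissible \<Omega> M" "negligible Z"
    "\<And>r x. r \<in> Rg \<Longrightarrow> x \<in> Dm r \<Longrightarrow> x \<in> (\<Union>i<N r. strip (e r) (f r) (w r) (a r i) (c r i)) \<Longrightarrow>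
      x \<notin> (\<Union>r'\<in>Rg. {x. \<alpha> r' + h \<le> x \<bullet> e r'} \<inter> (\<Union>i<N r'. strip (e r') (f r') (w r') (a r' i) (c r' i))) \<Longrightarrow>
      x \<notin> Z \<Longrightarrow> 1 / (1 + (norm (grad u x))\<^sup>2) \<le> 1 / (1 + (g r)\<^sup>2) + (\<rho> r)\<^sup>2"
proof -
  define S where "S r i = strip (e r) (f r) (w r) (a r i) (c r i)" for r i
  define T where "T = (\<Union>r\<in>Rg. {x. \<alpha> r + h \<le> x \<bullet> e r} \<inter> (\<Union>i<N r. S r i))"
  \<comment> \<open>Every cell gives up the trenches of all regions, and inside its own region also
    the strips with smaller index, so overlapping translates still yield disjoint cells.\<close>
  define P where "P p = Dm (fst p) \<inter> S (fst p) (snd p) - (\<Union>l<snd p. S (fst p) l) - T" for p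
  define Q where "Q p = interior (P p)" for p
  define I where "I = Sigma Rg (\<lambda>r. {..<N r})"
  define v where "v p = facet_slope (e (fst p)) (f (fst p)) (g (fst p)) (a (fst p) (snd p))" for p
  \<comment> \<open>This offset makes cells with a smaller index lower.  The ray from cell i stays in strip i, and there
    it can only meet cells with index at most i, since later strips lose their points to earlier ones.\<close>
  define o' where "o' r i = (real (N r) - 1 - real i) * (\<rho> r * w r)" for r i
  \<comment> \<open>The part of the facet height that comes from the position across the strip:
    constant along rays, and between 0 and \<rho> * w on the strip.\<close>
  define s where "s r i x = a r i * (x \<bullet> f r - a r i * (x \<bullet> e r) - c r i) / (1 + (a r i)\<^sup>2)" for r i x
  define k where "k p = M + g (fst p) * (\<alpha> (fst p) + a (fst p) (snd p) * c (fst p) (snd p) / (1 + (a (fst p) (snd p))\<^sup>2)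
      - o' (fst p) (snd p))" for p
  have val: "v (r, i) \<bullet> x + k (r, i) = M - g r * ((x \<bullet> e r - \<alpha> r) + s r i x + o' r i)" if "r \<in> Rg" for r i x
    unfolding v_def k_def fst_conv snd_conv facet_slope_inner[OF ef[OF that]] s_def
    by (simp add: algebra_simps diff_divide_distrib add_divide_distrib)
  have norm_v: "(norm (v (r, i)))\<^sup>2 = (g r)\<^sup>2 / (1 + (a r i)\<^sup>2)" if "r \<in> Rg" for r i
    unfolding v_def fst_conv snd_conv by (rule norm_facet_slope[OF ef[OF that]])
  have a2: "1 \<le> 1 + (a r i)\<^sup>2" for r i by simp
  have s_bounds: "0 \<le> s r i x \<and> s r i x \<le> \<rho> r * w r" if r: "r \<in> Rg" and x: "x \<in> S r i" for r i x
  proof -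
    define z where "z = x \<bullet> f r - a r i * (x \<bullet> e r) - c r i"
    have z: "0 \<le> z" "z \<le> w r" using x by (auto simp: S_def strip_def z_def)
    have az: "0 \<le> a r i * z" "a r i * z \<le> \<rho> r * w r"
      using a[OF r, of i] z by (auto intro: mult_mono)
    have "a r i * z / (1 + (a r i)\<^sup>2) \<le> a r i * z / 1"
      using az by (intro divide_left_mono) (auto simp: add_pos_nonneg)
    then show ?thesis using az a2[of r i] by (auto simp: s_def z_def[symmetric])
  qed
  have o_bounds: "0 \<le> o' r i" "\<rho> r * w r + o' r i \<le> \<rho> r * w r * real (N r)" if "r \<in> Rg" "i < N r" for r i
  proof -
    have \<rho>w: "0 \<le> \<rho> r * w r" using \<rho>[OF that(1)] w[OF that(1)] by simp
    show "0 \<le> o' r i" unfolding o'_def using \<rho>w that(2) by (intro mult_nonneg_nonneg[OF _ \<rho>w]) auto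
    have "(real (N r) - 1 - real i + 1) * (\<rho> r * w r) \<le> real (N r) * (\<rho> r * w r)"
      using \<rho>w by (intro mult_right_mono) auto
    then show "\<rho> r * w r + o' r i \<le> \<rho> r * w r * real (N r)"
      unfolding o'_def by (simp add: algebra_simps)
  qed
  have val_bounds: "M - \<delta> \<le> v (r, i) \<bullet> x + k (r, i) \<and> v (r, i) \<bullet> x + k (r, i) \<le> M"
    if r: "r \<in> Rg" and i: "i < N r" and x: "x \<in> P (r, i)" for r i x
  proof -
    have xS: "x \<in> S r i" "x \<in> Dm r" using x by (auto simp: P_def)
    have "0 \<le> (x \<bullet> e r - \<alpha> r) + s r i x + o' r i"
      using Dm(2)[OF r xS(2)] s_bounds[OF r xS(1)] o_bounds[OF r i] by linarith
    moreover have "(x \<bullet> e r - \<alpha> r) + s r i x + o' r i \<le> h + \<rho> r * w r * real (N r)"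
      using Dm(2)[OF r xS(2)] s_bounds[OF r xS(1)] o_bounds[OF r i] by linarith
    ultimately have "0 \<le> g r * ((x \<bullet> e r - \<alpha> r) + s r i x + o' r i)"
      "g r * ((x \<bullet> e r - \<alpha> r) + s r i x + o' r i) \<le> g r * (h + \<rho> r * w r * real (N r))"
      using g(1)[OF r] by (auto intro: mult_left_mono)
    then show ?thesis unfolding val[OF r] using g(2)[OF r] by linarith
  qed
  \<comment> \<open>Reparametrised by the progress \<tau> along e, the particle loses height at the
    rate (g^2 - q) / (2 g) with q = 1 + a^2. The tilt thus only helps, and the rate of the untilted
    ray is a safe bound.\<close>
  have ray: "\<exists>\<tau>>0. x - t *\<^sub>R v (r, i) = x + \<tau> *\<^sub>R (e r + a r i *\<^sub>R f r) \<and>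
      t * (1/2 * (1 - (norm (v (r, i)))\<^sup>2)) \<ge> - (\<tau> * (((g r)\<^sup>2 - 1) / (2 * g r)))"
    if r: "r \<in> Rg" and t: "0 < t" for r i x t
  proof -
    define q where "q = 1 + (a r i)\<^sup>2"
    have q: "1 \<le> q" using a2 by (simp add: q_def)
    have g1: "1 \<le> g r" by (rule g(1)[OF r])
    define \<tau> where "\<tau> = t * g r / q"
    have \<tau>: "0 < \<tau>" using t g1 q by (simp add: \<tau>_def)
    have tt: "t = \<tau> * q / g r" using q g1 by (simp add: \<tau>_def)
    have "x - t *\<^sub>R v (r, i) = x + \<tau> *\<^sub>R (e r + a r i *\<^sub>R f r)"
      by (simp add: v_def facet_slope_def \<tau>_def q_def)
    moreover have "t * (1/2 * (1 - (norm (v (r, i)))\<^sup>2)) = \<tau> * ((q - (g r)\<^sup>2) / (2 * g r))"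
      unfolding norm_v[OF r] q_def[symmetric] tt using q g1 by (simp add: field_simps)
    moreover have "\<tau> * ((q - (g r)\<^sup>2) / (2 * g r)) \<ge> \<tau> * ((1 - (g r)\<^sup>2) / (2 * g r))"
      using q g1 \<tau> by (intro mult_left_mono divide_right_mono) auto
    moreover have "\<tau> * ((1 - (g r)\<^sup>2) / (2 * g r)) = - (\<tau> * (((g r)\<^sup>2 - 1) / (2 * g r)))"
      by (simp add: minus_divide_left right_diff_distrib[symmetric] flip: mult_minus_right)
    ultimately show ?thesis using \<tau> by (intro exI[of _ \<tau>]) simp
  qed
  have ray_coord: "(x + \<tau> *\<^sub>R (e r + b *\<^sub>R f r)) \<bullet> e r = x \<bullet> e r + \<tau>"
    "(x + \<tau> *\<^sub>R (e r + b *\<^sub>R f r)) \<bullet> f r = x \<bullet> f r + \<tau> * b" if "r \<in> Rg" for r x \<tau> b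
    using orthonormal2_inner[OF ef[OF that]] by (simp_all add: inner_add_left)
  have polyS: "polygonal (S r i)" if "r \<in> Rg" for r i
    unfolding S_def by (rule polygonal_strip[OF ef[OF that]])
  have polyT: "polygonal T"
    unfolding T_def
  proof (intro polygonal_UN Rg polygonal_Int)
    fix r assume r: "r \<in> Rg"
    have "e r \<noteq> 0" using ef[OF r] by (auto simp: orthonormal2_def)
    then show "polygonal {x. \<alpha> r + h \<le> x \<bullet> e r}" by (rule polygonal_inner_halfspaces)
    show "polygonal (S r i)" for i by (rule polyS[OF r])
  qed auto
  have polyP: "polygonal (P p)" if "p \<in> I" for p
    using that Dm(1) polyS polyT unfolding P_def I_def
    by (auto intro!: polygonal_Diff polygonal_Int polygonal_UN)
  have I: "finite I" using Rg by (simp add: I_def)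
  have QP: "x \<in> P p" if "x \<in> Q p" for x p using that interior_subset by (auto simp: Q_def)
  have M0: "0 \<le> M - \<delta>" using \<delta> by simp
  have hit_region: "r = r' \<and> l \<le> i"
    if r: "r \<in> Rg" "i < N r" "x \<in> P (r, i)" and r': "r' \<in> Rg" "y \<in> P (r', l)"
      and y: "y = x + \<tau> *\<^sub>R (e r + a r i *\<^sub>R f r)" and \<tau>: "0 \<le> \<tau>" for r i x r' l y \<tau>
  proof -
    have x: "x \<in> Dm r" "x \<in> S r i" using r by (auto simp: P_def)
    have yD: "y \<in> Dm r'" "y \<notin> T" "y \<in> S r' l" using r' by (auto simp: P_def)
    have yc: "y \<bullet> e r = x \<bullet> e r + \<tau>" "y \<bullet> f r = x \<bullet> f r + \<tau> * a r i"
      unfolding y by (rule ray_coord[OF r(1)])+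
    have yS: "y \<in> S r i"
      using x(2) unfolding S_def strip_def mem_Collect_eq yc by (simp add: algebra_simps)
    have lt: "y \<bullet> e r < \<alpha> r + h"
      using yD(2) yS r unfolding T_def by force
    have "\<tau> < h" using lt yc Dm(2)[OF r(1) x(1)] by linarith
    have "norm (y - x) \<le> \<tau> * norm (e r + a r i *\<^sub>R f r)" using \<tau> by (simp add: y)
    also have "\<dots> \<le> \<tau> * 2"
    proof (rule mult_left_mono[OF _ \<tau>])
      have "norm (e r + a r i *\<^sub>R f r) \<le> norm (e r) + norm (a r i *\<^sub>R f r)" by (rule norm_triangle_ineq)
      also have "\<dots> \<le> 2" using ef[OF r(1)] a[OF r(1), of i] \<rho>[OF r(1)] by (auto simp: orthonormal2_def)
      finally show "norm (e r + a r i *\<^sub>R f r) \<le> 2" .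
    qed
    finally have "norm (y - x) < 2 * h" using \<open>\<tau> < h\<close> by simp
    then have rr: "r = r'"
      using sep[OF r(1) r'(1) x(1) yD(1)] lt yc Dm(2)[OF r(1) x(1)] \<tau> by simp
    moreover have "l \<le> i"
    proof (rule ccontr)
      assume "\<not> l \<le> i"
      then have "y \<notin> P (r', l)" using yS rr by (auto simp: P_def)
      then show False using r' by simp
    qed
    ultimately show ?thesis by simp
  qed
  \<comment> \<open>Passing to interiors makes the exceptional lines part of the zero set, where a regular point is a
    minimum of u and the gradient vanishes.\<close>
  obtain u where u: "u \<in> admissible \<Omega> M" "\<And>p x. p \<in> I \<Longrightarrow> x \<in> Q p \<Longrightarrow> grad u x = v p"
  proof (rule piecewise_affine_admissible[of \<Omega> M I Q v k, OF \<Omega> _ I])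
    show "0 \<le> M"
      using \<delta> by simp
    show "open (Q p)" "polygonal (Q p)" if "p \<in> I" for p
      using polyP[OF that] by (auto simp: Q_def intro: polygonal_interior)
    show "p = p'" if pp: "p \<in> I" "p' \<in> I" "x \<in> Q p" "x \<in> Q p'" for p p' x
    proof -
      obtain r i where p: "p = (r, i)" "r \<in> Rg" "i < N r" using pp(1) by (auto simp: I_def)
      obtain r' i' where p': "p' = (r', i')" "r' \<in> Rg" "i' < N r'" using pp(2) by (auto simp: I_def)
      have x: "x \<in> P (r, i)" "x \<in> P (r', i')" using pp QP p p' by auto
      have "r = r' \<and> i' \<le> i" by (rule hit_region[OF p(2,3) x(1) p'(2) x(2), of 0]) auto
      moreover have "r' = r \<and> i \<le> i'" by (rule hit_region[OF p'(2,3) x(2) p(2) x(1), of 0]) auto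
      ultimately show ?thesis using p p' by simp
    qed
    show "0 \<le> v p \<bullet> x + k p \<and> v p \<bullet> x + k p \<le> M" if p: "p \<in> I" "x \<in> Q p" for p x
      using val_bounds[of "fst p" "snd p" x] p QP[OF p(2)] M0 by (auto simp: I_def)
    fix p x t assume p: "p \<in> I" "x \<in> Q p" and t: "t > 0" and y: "x - t *\<^sub>R v p \<in> closure \<Omega>"
    obtain r i where ri: "p = (r, i)" "r \<in> Rg" "i < N r" using p(1) by (auto simp: I_def)
    have xP: "x \<in> P (r, i)" using QP p ri by auto
    then have x: "x \<in> Dm r" "x \<in> S r i" by (auto simp: P_def)
    obtain \<tau> where \<tau>: "0 < \<tau>" "x - t *\<^sub>R v (r, i) = x + \<tau> *\<^sub>R (e r + a r i *\<^sub>R f r)"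
      "t * (1/2 * (1 - (norm (v (r, i)))\<^sup>2)) \<ge> - (\<tau> * (((g r)\<^sup>2 - 1) / (2 * g r)))"
      using ray[OF ri(2) t, where i=i and x=x] by blast
    have g1: "1 \<le> g r" by (rule g(1)[OF ri(2)])
    \<comment> \<open>The bound for the height lost by the particle per unit of progress along e, to
      be compared with the drop g of the facet.\<close>
    define G where "G = ((g r)\<^sup>2 - 1) / (2 * g r)"
    have G: "0 \<le> G" "G \<le> g r"
    proof -
      have "1 \<le> (g r)\<^sup>2" using g1 by (rule one_le_power)
      then show "0 \<le> G" using g1 by (simp add: G_def)
      have "(g r)\<^sup>2 - 1 \<le> 2 * (g r)\<^sup>2" by (smt (verit) zero_le_power2)
      then have "G \<le> 2 * (g r)\<^sup>2 / (2 * g r)" unfolding G_def using g1 by (intro divide_right_mono) auto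
      then show "G \<le> g r" using g1 by (simp add: power2_eq_square)
    qed
    show "0 \<le> v p \<bullet> x + k p + t * (1/2 * (1 - (norm (v p))\<^sup>2))"
    proof -
      have "\<tau> \<le> X r"
        using exit(1)[OF ri(2) x(1) y] ray_coord(1)[OF ri(2), of x \<tau> "a r i"] \<tau>(2) by (simp add: ri)
      then have "\<tau> * G \<le> X r * G" using G by (intro mult_right_mono)
      also have "\<dots> \<le> M - \<delta>" using exit(2)[OF ri(2)] g1 by (simp add: G_def field_simps)
      finally have "\<tau> * G \<le> M - \<delta>" .
      then show ?thesis
        using \<tau>(3) val_bounds[OF ri(2,3) xP] unfolding G_def[symmetric] ri(1) by linarith
    qed
    fix p' assume p': "p' \<in> I" "x - t *\<^sub>R v p \<in> Q p'"
    define y where "y = x - t *\<^sub>R v p"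
    obtain r' l where rl: "p' = (r', l)" "r' \<in> Rg" "l < N r'" using p'(1) by (auto simp: I_def)
    have yP: "y \<in> P (r', l)" using QP p' rl by (auto simp: y_def)
    have y_eq: "y = x + \<tau> *\<^sub>R (e r + a r i *\<^sub>R f r)" using \<tau>(2) ri by (simp add: y_def)
    have rr: "r' = r" "l \<le> i"
      using hit_region[OF ri(2,3) xP rl(2) yP y_eq] \<tau>(1) by auto
    have yc: "y \<bullet> e r = x \<bullet> e r + \<tau>" "y \<bullet> f r = x \<bullet> f r + \<tau> * a r i"
      unfolding y_eq by (rule ray_coord[OF ri(2)])+
    \<comment> \<open>In the strip of the ray s does not change. In an earlier strip the offset is
      larger by at least \<rho> * w, which is the whole range of s.\<close>
    have so: "s r i x + o' r i \<le> s r l y + o' r l"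
    proof (cases "l = i")
      case True
      then show ?thesis by (simp add: s_def yc algebra_simps)
    next
      case False
      then have "1 \<le> real i - real l" using rr by linarith
      moreover have "0 \<le> \<rho> r * w r" using \<rho>[OF ri(2)] w[OF ri(2)] by simp
      ultimately have "1 * (\<rho> r * w r) \<le> (real i - real l) * (\<rho> r * w r)" by (rule mult_right_mono)
      then have "\<rho> r * w r + o' r i \<le> o' r l" by (simp add: o'_def algebra_simps)
      moreover have "y \<in> S r l" using yP rr by (simp add: P_def)
      ultimately show ?thesis using s_bounds[OF ri(2) x(2)] s_bounds[OF ri(2), of y l] by linarith
    qed
    have "v p' \<bullet> y + k p' = M - g r * ((x \<bullet> e r - \<alpha> r) + \<tau> + (s r l y + o' r l))"
      unfolding rl(1) rr(1) val[OF ri(2)] yc by (simp add: algebra_simps)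
    also have "\<dots> \<le> M - g r * ((x \<bullet> e r - \<alpha> r) + \<tau> + (s r i x + o' r i))"
      using so g1 by (intro diff_left_mono mult_left_mono add_left_mono) auto
    also have "\<dots> = (v p \<bullet> x + k p) - \<tau> * g r"
      unfolding ri(1) val[OF ri(2)] by (simp add: algebra_simps)
    also have "\<dots> \<le> (v p \<bullet> x + k p) - \<tau> * G" using G \<tau>(1) by (intro diff_left_mono mult_left_mono) auto
    also have "\<dots> \<le> v p \<bullet> x + k p + t * (1/2 * (1 - (norm (v p))\<^sup>2))"
      using \<tau>(3) unfolding G_def[symmetric] ri(1) by linarith
    finally show "v p' \<bullet> (x - t *\<^sub>R v p) + k p' \<le> v p \<bullet> x + k p + t * (1/2 * (1 - (norm (v p))\<^sup>2))"
      by (simp add: y_def)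
  qed (rule that)
  define Z where "Z = (\<Union>p\<in>I. frontier (P p))"
  show thesis
  proof (rule that[OF u(1), of Z])
    show "negligible Z"
      unfolding Z_def using I polyP polygonal_negligible_frontier by (intro negligible_Union) auto
    fix r x assume r: "r \<in> Rg" and x: "x \<in> Dm r"
      and xS: "x \<in> (\<Union>i<N r. strip (e r) (f r) (w r) (a r i) (c r i))"
      and xT: "x \<notin> (\<Union>r'\<in>Rg. {x. \<alpha> r' + h \<le> x \<bullet> e r'} \<inter> (\<Union>i<N r'. strip (e r') (f r') (w r') (a r' i) (c r' i)))"
      and xZ: "x \<notin> Z"
    \<comment> \<open>The first strip that contains x is the one whose cell keeps x.\<close>
    define i where "i = (LEAST i. x \<in> S r i)"
    obtain i0 where i0: "i0 < N r" "x \<in> S r i0" using xS by (auto simp: S_def)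
    have i: "x \<in> S r i" "i \<le> i0" using i0 unfolding i_def by (auto intro: LeastI Least_le)
    have "x \<notin> S r l" if "l < i" for l using that not_less_Least unfolding i_def by blast
    then have xP: "x \<in> P (r, i)"
      using x i xT by (auto simp: P_def T_def S_def)
    have rI: "(r, i) \<in> I" using r i i0 by (simp add: I_def)
    have "x \<in> Q (r, i)" using xP xZ rI closure_subset by (fastforce simp: Z_def frontier_def Q_def)
    then have gr: "grad u x = v (r, i)" by (rule u(2)[OF rI])
    define q where "q = 1 + (a r i)\<^sup>2"
    have q: "1 \<le> q" using a2 by (simp add: q_def)
    have "(a r i)\<^sup>2 \<le> (\<rho> r)\<^sup>2" using a[OF r, of i] by (intro power_mono) auto
    \<comment> \<open>The tilt reduces the squared slope from g^2 to g^2 / q with q = 1 + a^2, and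
      this raises the density by at most q - 1.\<close>
    moreover have "1 / (1 + (norm (grad u x))\<^sup>2) \<le> 1 / (1 + (g r)\<^sup>2) + (a r i)\<^sup>2"
    proof -
      have gp: "0 < 1 + (g r)\<^sup>2" by (simp add: add_pos_nonneg)
      have "1 / (1 + (g r)\<^sup>2 / q) = q / (q + (g r)\<^sup>2)" using q by (simp add: field_simps)
      also have "\<dots> \<le> q / (1 + (g r)\<^sup>2)" using q gp by (intro divide_left_mono) auto
      also have "\<dots> = 1 / (1 + (g r)\<^sup>2) + (a r i)\<^sup>2 / (1 + (g r)\<^sup>2)" by (simp add: q_def add_divide_distrib)
      also have "\<dots> \<le> 1 / (1 + (g r)\<^sup>2) + (a r i)\<^sup>2 / 1"
        by (intro add_left_mono divide_left_mono) (auto simp: add_pos_nonneg)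
      finally show ?thesis by (simp add: gr norm_v[OF r] q_def)
    qed
    ultimately show "1 / (1 + (norm (grad u x))\<^sup>2) \<le> 1 / (1 + (g r)\<^sup>2) + (\<rho> r)\<^sup>2" by linarith
  qed
qed

section \<open>The infimum\<close>

lemma near_optimal_admissible:
  fixes \<Omega> :: "(real^2) set"
  assumes \<Omega>: "convex \<Omega>" "open \<Omega>" "bounded \<Omega>" and M: "0 < M" and \<epsilon>: "0 < \<epsilon>"
  shows "\<exists>u\<in>admissible \<Omega> M. resistance \<Omega> u \<le> phi \<Omega> M + \<epsilon>"
proof -
  have "\<exists>R>0. \<forall>x\<in>\<Omega>. norm x \<le> R" using \<Omega>(3) bounded_pos[of \<Omega>] by simp
  then obtain R where R: "0 < R" "\<forall>x\<in>\<Omega>. norm x \<le> R" by auto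
  have \<Omega>R: "\<Omega> \<subseteq> cball 0 R" using R by auto
  have dR: "infdist x (frontier \<Omega>) \<le> 2 * R" if x: "x \<in> \<Omega>" for x
  proof -
    obtain p where p: "p \<in> frontier \<Omega>" using infdist_frontier_pos(2)[OF \<Omega>(2,3) x] by blast
    have "closure \<Omega> \<subseteq> cball 0 R" using \<Omega>R by (intro closure_minimal) auto
    then have "norm p \<le> R" using p by (auto simp: frontier_def)
    moreover have "infdist x (frontier \<Omega>) \<le> dist x p" using p by (rule infdist_le)
    moreover have "dist x p \<le> norm x + norm p" by (simp add: dist_norm norm_triangle_ineq4)
    ultimately show ?thesis using R x by fastforce
  qed
  define A where "A = measure lebesgue \<Omega>"
  \<comment> \<open>The constant of \<open>optimal_density_perturb\<close>, with 2 R as the bound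
    for all distances to the frontier.\<close>
  define C where "C = 2 * (2 * M + 2 * R) / M\<^sup>2"
  have A0: "0 \<le> A" by (simp add: A_def)
  have C0: "0 \<le> C" using M R by (simp add: C_def)
  \<comment> \<open>The total error will be \<delta> * E: an excess of (C + 1) * \<delta> in the
    density over the area A, and \<delta> for each of three bad sets.\<close>
  define E where "E = (C + 1) * A + 3"
  have E: "3 \<le> E" using A0 C0 by (simp add: E_def)
  define \<delta> where "\<delta> = min (M / 2) (\<epsilon> / E)"
  have \<delta>: "0 < \<delta>" "\<delta> \<le> M / 2" "\<delta> * E \<le> \<epsilon>"
  proof -
    show "0 < \<delta>" using M \<epsilon> E by (auto simp: \<delta>_def)
    show "\<delta> \<le> M / 2" unfolding \<delta>_def by (rule min.cobounded1)
    have "\<delta> * E \<le> \<epsilon> / E * E" using E by (intro mult_right_mono) (auto simp: \<delta>_def)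
    then show "\<delta> * E \<le> \<epsilon>" using E by simp
  qed
  obtain \<K> where \<K>: "finite \<K>" "\<And>K. K \<in> \<K> \<Longrightarrow> \<exists>c d. K = cbox c d"
    "\<And>K L. K \<in> \<K> \<Longrightarrow> L \<in> \<K> \<Longrightarrow> K \<noteq> L \<Longrightarrow> K \<inter> L = {}"
    "\<And>K. K \<in> \<K> \<Longrightarrow> \<exists>x\<in>\<Omega>. K \<subseteq> ball x \<delta> \<inter> \<Omega>"
    "measure lebesgue (\<Omega> - \<Union>\<K>) \<le> \<delta>"
    by (rule box_packing[OF \<Omega>(2,3) \<delta>(1) \<delta>(1)]) (rule that)
  have compK: "compact K" if "K \<in> \<K>" for K using \<K>(2)[OF that] compact_cbox by blast
  have "\<forall>K\<in>\<K>. \<exists>z. case z of (x, e, f, g) \<Rightarrow> x \<in> \<Omega> \<and> K \<subseteq> ball x \<delta> \<inter> \<Omega> \<and> orthonormal2 e f \<and>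
      (\<forall>y\<in>closure \<Omega>. (y - x) \<bullet> e \<le> infdist x (frontier \<Omega>)) \<and>
      1 \<le> g \<and> g \<le> 2 * M / \<delta> + 1 \<and>
      (g\<^sup>2 - 1) * (infdist x (frontier \<Omega>) + \<delta>) = 2 * (M - \<delta>) * g \<and>
      1 / (1 + g\<^sup>2) = optimal_density (M - \<delta>) (infdist x (frontier \<Omega>) + \<delta>)"
  proof
    fix K assume "K \<in> \<K>"
    then obtain x where x: "x \<in> \<Omega>" "K \<subseteq> ball x \<delta> \<inter> \<Omega>" using \<K>(4) by blast
    obtain e where e: "norm e = 1" "\<And>y. y \<in> closure \<Omega> \<Longrightarrow> (y - x) \<bullet> e \<le> infdist x (frontier \<Omega>)"
      by (rule exit_direction[OF \<Omega> x(1)]) (rule that)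
    obtain f where f: "orthonormal2 e f" using orthonormal2_ex[OF e(1)] .
    \<comment> \<open>The distance at the centre plus the radius \<delta> bounds the run from every
      point of the box. The slope is solved for height M - \<delta> because the facets may lie that
      low. As D is at least \<delta>, all slopes have the common bound 2 M / \<delta> + 1.\<close>
    define D where "D = infdist x (frontier \<Omega>) + \<delta>"
    have D: "\<delta> \<le> D" "0 < D" using \<delta> infdist_nonneg[of x "frontier \<Omega>"] by (auto simp: D_def)
    have M\<delta>: "0 < M - \<delta>" using \<delta> M by simp
    obtain g where g: "1 \<le> g" "g \<le> 2 * (M - \<delta>) / D + 1" "(g\<^sup>2 - 1) * D = 2 * (M - \<delta>) * g"
      "1 / (1 + g\<^sup>2) = optimal_density (M - \<delta>) D"
      using optimal_density_attained[OF M\<delta> D(2)] .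
    have "2 * (M - \<delta>) / D \<le> 2 * M / \<delta>" using D \<delta> M by (intro frac_le) auto
    then have "g \<le> 2 * M / \<delta> + 1" using g(2) by simp
    then show "\<exists>z. case z of (x, e, f, g) \<Rightarrow> x \<in> \<Omega> \<and> K \<subseteq> ball x \<delta> \<inter> \<Omega> \<and> orthonormal2 e f \<and>
      (\<forall>y\<in>closure \<Omega>. (y - x) \<bullet> e \<le> infdist x (frontier \<Omega>)) \<and>
      1 \<le> g \<and> g \<le> 2 * M / \<delta> + 1 \<and>
      (g\<^sup>2 - 1) * (infdist x (frontier \<Omega>) + \<delta>) = 2 * (M - \<delta>) * g \<and>
      1 / (1 + g\<^sup>2) = optimal_density (M - \<delta>) (infdist x (frontier \<Omega>) + \<delta>)"
      using x e(2) f g(1,3,4) unfolding D_def by (intro exI[of _ "(x, e, f, g)"]) simp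
  qed
  from bchoice[OF this] obtain q where q: "\<forall>K\<in>\<K>. case q K of (x, e, f, g) \<Rightarrow>
      x \<in> \<Omega> \<and> K \<subseteq> ball x \<delta> \<inter> \<Omega> \<and> orthonormal2 e f \<and>
      (\<forall>y\<in>closure \<Omega>. (y - x) \<bullet> e \<le> infdist x (frontier \<Omega>)) \<and>
      1 \<le> g \<and> g \<le> 2 * M / \<delta> + 1 \<and>
      (g\<^sup>2 - 1) * (infdist x (frontier \<Omega>) + \<delta>) = 2 * (M - \<delta>) * g \<and>
      1 / (1 + g\<^sup>2) = optimal_density (M - \<delta>) (infdist x (frontier \<Omega>) + \<delta>)" ..
  define x0 e f g where "x0 K = fst (q K)" and "e K = fst (snd (q K))"
    and "f K = fst (snd (snd (q K)))" and "g K = snd (snd (snd (q K)))" for K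
  define D where "D K = infdist (x0 K) (frontier \<Omega>) + \<delta>" for K
  have x0: "x0 K \<in> \<Omega>" "K \<subseteq> ball (x0 K) \<delta> \<inter> \<Omega>" and ef: "orthonormal2 (e K) (f K)"
    and ex: "\<forall>y\<in>closure \<Omega>. (y - x0 K) \<bullet> e K \<le> infdist (x0 K) (frontier \<Omega>)"
    and g: "1 \<le> g K" "g K \<le> 2 * M / \<delta> + 1" "((g K)\<^sup>2 - 1) * D K = 2 * (M - \<delta>) * g K"
      "1 / (1 + (g K)\<^sup>2) = optimal_density (M - \<delta>) (D K)" if "K \<in> \<K>" for K
    using bspec[OF q that] by (simp_all add: case_prod_beta x0_def e_def f_def g_def D_def)
  have e1: "norm (e K) = 1" if "K \<in> \<K>" for K using ef[OF that] by (simp add: orthonormal2_def)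
  obtain s where s: "0 < s"
    "\<And>K L x y. K \<in> \<K> \<Longrightarrow> L \<in> \<K> \<Longrightarrow> x \<in> K \<Longrightarrow> y \<in> L \<Longrightarrow> dist x y < s \<Longrightarrow> K = L"
    by (rule disjoint_compact_family_separated[OF \<K>(1) compK \<K>(3)]) (assumption | rule that)+
  define G where "G = 2 * M / \<delta> + 1"
  have G: "1 \<le> G" using M \<delta> by (simp add: G_def)
  \<comment> \<open>2 h \<le> s keeps different boxes out of reach of short rays. The second bound
    makes a facet of slope at most G drop by at most \<delta> / 2 over the thickness of the
    slab.\<close>
  define h where "h = min (s / 2) (\<delta> / (2 * G))"
  have h: "0 < h" "2 * h \<le> s" "h \<le> \<delta> / (2 * G)" using s(1) \<delta> G by (auto simp: h_def)
  define J :: int where "J = \<lceil>R / h\<rceil>"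
  define Rg where "Rg = \<K> \<times> {- J - 1..J}"
  have Rg: "finite Rg" using \<K>(1) by (simp add: Rg_def)
  \<comment> \<open>Chosen once the number of regions is known: \<delta> / (2 G) pays for the
    staggering of the cells, and the last bound keeps the uncovered parts of all regions together
    below \<delta>, and likewise all trenches.\<close>
  define \<eta> where "\<eta> = min (\<delta> / (2 * G)) (min 1 (\<delta> / (real (card Rg) + 1)))"
  have \<eta>: "0 < \<eta>" "\<eta> \<le> \<delta> / (2 * G)" "\<eta> \<le> 1" "\<eta> \<le> \<delta> / (real (card Rg) + 1)"
    using \<delta> G by (auto simp: \<eta>_def)
  have card_\<eta>: "real (card Rg) * \<eta> \<le> \<delta>"
  proof -
    have "real (card Rg) * \<eta> \<le> real (card Rg) * (\<delta> / (real (card Rg) + 1))"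
      using \<eta> by (intro mult_left_mono) auto
    also have "\<dots> \<le> \<delta>" using \<delta> by (simp add: field_simps)
    finally show ?thesis .
  qed
  have \<eta>\<delta>: "\<eta> \<le> \<delta>"
  proof -
    have "\<delta> / (real (card Rg) + 1) \<le> \<delta> / 1" using \<delta> by (intro divide_left_mono) auto
    then show ?thesis using \<eta>(4) by simp
  qed
  define \<alpha> where "\<alpha> r = real_of_int (snd r) * h" for r :: "(real^2) set \<times> int"
  define Slab where "Slab r = {x. \<alpha> r \<le> x \<bullet> e (fst r) \<and> x \<bullet> e (fst r) < \<alpha> r + h}" for r
  define Strips where "Strips r N w a c = (\<Union>i<(N::nat). strip (e (fst r)) (f (fst r)) w (a i) (c i))"
    for r :: "(real^2) set \<times> int" and w a c N
  have "\<forall>r\<in>Rg. \<exists>z. case z of (N, w, \<rho>, a, c) \<Rightarrow> 0 < w \<and> 0 \<le> \<rho> \<and> \<rho> \<le> 1 \<and> \<rho> \<le> \<eta> \<and> \<rho> * w * real N \<le> \<eta> \<and>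
      (\<forall>i. 0 \<le> a i \<and> a i \<le> \<rho>) \<and>
      measure lebesgue (cball 0 R \<inter> Slab r - Strips r N w a c) \<le> \<eta> \<and>
      measure lebesgue (cball 0 R \<inter> {x. \<alpha> r + h \<le> x \<bullet> e (fst r)} \<inter> Strips r N w a c) \<le> \<eta>"
  proof
    fix r assume "r \<in> Rg"
    then have K: "fst r \<in> \<K>" by (auto simp: Rg_def)
    have lt: "\<alpha> r < \<alpha> r + h" using h by simp
    obtain N :: nat and w \<rho> :: real and a c :: "nat \<Rightarrow> real" where
      *: "0 < w" "0 \<le> \<rho>" "\<rho> \<le> 1" "\<rho> \<le> \<eta>" "\<rho> * w * real N \<le> \<eta>"
      "\<And>i. 0 \<le> a i \<and> a i \<le> \<rho>"
      "measure lebesgue (cball 0 R \<inter> {x. \<alpha> r \<le> x \<bullet> e (fst r) \<and> x \<bullet> e (fst r) < \<alpha> r + h} -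
        (\<Union>i<N. strip (e (fst r)) (f (fst r)) w (a i) (c i))) \<le> \<eta>"
      "measure lebesgue (cball 0 R \<inter> {x. \<alpha> r + h \<le> x \<bullet> e (fst r)} \<inter>
        (\<Union>i<N. strip (e (fst r)) (f (fst r)) w (a i) (c i))) \<le> \<eta>"
      by (rule slab_strips[OF ef[OF K] lt R(1) \<eta>(1)]) (rule that)
    show "\<exists>z. case z of (N, w, \<rho>, a, c) \<Rightarrow> 0 < w \<and> 0 \<le> \<rho> \<and> \<rho> \<le> 1 \<and> \<rho> \<le> \<eta> \<and> \<rho> * w * real N \<le> \<eta> \<and>
      (\<forall>i. 0 \<le> a i \<and> a i \<le> \<rho>) \<and>
      measure lebesgue (cball 0 R \<inter> Slab r - Strips r N w a c) \<le> \<eta> \<and>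
      measure lebesgue (cball 0 R \<inter> {x. \<alpha> r + h \<le> x \<bullet> e (fst r)} \<inter> Strips r N w a c) \<le> \<eta>"
      unfolding Slab_def Strips_def
      by (rule exI[of _ "(N, w, \<rho>, a, c)"], unfold prod.case)
         (intro conjI allI *(1-5,7,8) *(6)[THEN conjunct1] *(6)[THEN conjunct2])
  qed
  from bchoice[OF this] obtain p where p: "\<forall>r\<in>Rg. case p r of (N, w, \<rho>, a, c) \<Rightarrow>
      0 < w \<and> 0 \<le> \<rho> \<and> \<rho> \<le> 1 \<and> \<rho> \<le> \<eta> \<and> \<rho> * w * real N \<le> \<eta> \<and>
      (\<forall>i. 0 \<le> a i \<and> a i \<le> \<rho>) \<and>
      measure lebesgue (cball 0 R \<inter> Slab r - Strips r N w a c) \<le> \<eta> \<and>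
      measure lebesgue (cball 0 R \<inter> {x. \<alpha> r + h \<le> x \<bullet> e (fst r)} \<inter> Strips r N w a c) \<le> \<eta>" ..
  define N w \<rho> a c where "N r = fst (p r)" and "w r = fst (snd (p r))"
    and "\<rho> r = fst (snd (snd (p r)))" and "a r = fst (snd (snd (snd (p r))))"
    and "c r = snd (snd (snd (snd (p r))))" for r
  define S where "S r = Strips r (N r) (w r) (a r) (c r)" for r
  have w: "0 < w r" and \<rho>: "0 \<le> \<rho> r \<and> \<rho> r \<le> 1" "\<rho> r \<le> \<eta>" "\<rho> r * w r * real (N r) \<le> \<eta>"
    and a: "0 \<le> a r i \<and> a r i \<le> \<rho> r"
    and m1: "measure lebesgue (cball 0 R \<inter> Slab r - S r) \<le> \<eta>"
    and m2: "measure lebesgue (cball 0 R \<inter> {x. \<alpha> r + h \<le> x \<bullet> e (fst r)} \<inter> S r) \<le> \<eta>"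
    if "r \<in> Rg" for r i
    using bspec[OF p that]
    by (simp_all add: case_prod_beta N_def w_def \<rho>_def a_def c_def S_def)
  define Dm where "Dm r = fst r \<inter> Slab r" for r
  have RgK: "fst r \<in> \<K>" if "r \<in> Rg" for r using that by (auto simp: Rg_def)
  obtain u Z where u: "u \<in> admissible \<Omega> M" and Z: "negligible Z" and
    uZ: "\<And>r x. r \<in> Rg \<Longrightarrow> x \<in> Dm r \<Longrightarrow>
      x \<in> (\<Union>i<N r. strip (e (fst r)) (f (fst r)) (w r) (a r i) (c r i)) \<Longrightarrow>
      x \<notin> (\<Union>r'\<in>Rg. {x. \<alpha> r' + h \<le> x \<bullet> e (fst r')} \<inter>
        (\<Union>i<N r'. strip (e (fst r')) (f (fst r')) (w r') (a r' i) (c r' i))) \<Longrightarrow>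
      x \<notin> Z \<Longrightarrow> 1 / (1 + (norm (grad u x))\<^sup>2) \<le> 1 / (1 + (g (fst r))\<^sup>2) + (\<rho> r)\<^sup>2"
  proof (rule facet_admissible_function[of \<Omega> Rg \<delta> M "\<lambda>r. e (fst r)" "\<lambda>r. f (fst r)" Dm \<alpha> h w \<rho> a
        "\<lambda>r. g (fst r)" N "\<lambda>r. D (fst r)" c, OF \<Omega>(2,3) Rg])
    show "0 \<le> \<delta>" "\<delta> \<le> M" using \<delta> M by auto
    show "orthonormal2 (e (fst r)) (f (fst r))" if "r \<in> Rg" for r using ef RgK that by blast
    show "polygonal (Dm r)" if r: "r \<in> Rg" for r
    proof -
      have "polygonal (fst r)" using \<K>(2)[OF RgK[OF r]] polygonal_cbox by auto
      then show ?thesis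
        unfolding Dm_def Slab_def by (intro polygonal_Int polygonal_slab e1 RgK r)
    qed
    show "\<alpha> r \<le> x \<bullet> e (fst r) \<and> x \<bullet> e (fst r) < \<alpha> r + h" if "x \<in> Dm r" for r x
      using that by (simp add: Dm_def Slab_def)
    show "r = r'" if r: "r \<in> Rg" "r' \<in> Rg" and xy: "x \<in> Dm r" "y \<in> Dm r'" and near: "norm (y - x) < 2 * h"
      and sl: "\<alpha> r \<le> y \<bullet> e (fst r)" "y \<bullet> e (fst r) < \<alpha> r + h" for r r' x y
    proof -
      have "dist x y < s" using near h by (simp add: dist_norm norm_minus_commute)
      \<comment> \<open>Points of different boxes are at least s apart, so x and y share a box. Its
        slabs are disjoint and have a common direction, which then determines the slab as
        well.\<close>
      then have K: "fst r = fst r'"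
        using s(2)[OF RgK[OF r(1)] RgK[OF r(2)]] xy by (auto simp: Dm_def)
      have sl': "\<alpha> r' \<le> y \<bullet> e (fst r)" "y \<bullet> e (fst r) < \<alpha> r' + h"
        using xy(2) unfolding Dm_def Slab_def K by auto
      have "\<alpha> r < \<alpha> r' + h" "\<alpha> r' < \<alpha> r + h" using sl sl' by linarith+
      then have "real_of_int (snd r) * h < (real_of_int (snd r') + 1) * h"
        "real_of_int (snd r') * h < (real_of_int (snd r) + 1) * h"
        by (simp_all add: \<alpha>_def algebra_simps)
      then have "real_of_int (snd r) < real_of_int (snd r') + 1" "real_of_int (snd r') < real_of_int (snd r) + 1"
        using h(1) by (simp_all add: mult_less_cancel_right)
      then have "snd r = snd r'" by linarith
      then show ?thesis using K by (simp add: prod_eq_iff)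
    qed
    show "0 < w r" "0 \<le> \<rho> r \<and> \<rho> r \<le> 1" "0 \<le> a r i \<and> a r i \<le> \<rho> r" if "r \<in> Rg" for r i
      using w[OF that] \<rho>(1)[OF that] a[OF that] by auto
    show "1 \<le> g (fst r)" if "r \<in> Rg" for r using g(1) RgK that by blast
    show "g (fst r) * (h + \<rho> r * w r * real (N r)) \<le> \<delta>" if r: "r \<in> Rg" for r
    proof -
      have "h + \<rho> r * w r * real (N r) \<le> \<delta> / (2 * G) + \<delta> / (2 * G)"
        using h(3) \<rho>(3)[OF r] \<eta>(2) by linarith
      also have "\<dots> = \<delta> / G" by simp
      finally have "h + \<rho> r * w r * real (N r) \<le> \<delta> / G" .
      moreover have "0 \<le> h + \<rho> r * w r * real (N r)"
        using h(1) \<rho>(1)[OF r] w[OF r] by (intro add_nonneg_nonneg mult_nonneg_nonneg) auto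
      moreover have "g (fst r) \<le> G" "0 \<le> g (fst r)"
        using g(1,2)[OF RgK[OF r]] by (auto simp: G_def)
      ultimately have "g (fst r) * (h + \<rho> r * w r * real (N r)) \<le> G * (\<delta> / G)"
        using G by (intro mult_mono) auto
      then show ?thesis using G by simp
    qed
    show "y \<bullet> e (fst r) - x \<bullet> e (fst r) \<le> D (fst r)"
      if r: "r \<in> Rg" and x: "x \<in> Dm r" and y: "y \<in> closure \<Omega>" for r x y
    proof -
      note K = RgK[OF r]
      have "(x0 (fst r) - x) \<bullet> e (fst r) \<le> norm (x0 (fst r) - x) * norm (e (fst r))"
        by (rule norm_cauchy_schwarz)
      also have "\<dots> \<le> \<delta>" using x x0(2)[OF K] e1[OF K] by (auto simp: Dm_def dist_norm subset_iff)
      finally have "(x0 (fst r) - x) \<bullet> e (fst r) \<le> \<delta>" .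
      moreover have "(y - x0 (fst r)) \<bullet> e (fst r) \<le> infdist (x0 (fst r)) (frontier \<Omega>)"
        using ex[OF K] y by blast
      ultimately show ?thesis by (simp add: D_def inner_diff_left)
    qed
    show "((g (fst r))\<^sup>2 - 1) * D (fst r) \<le> 2 * (M - \<delta>) * g (fst r)" if "r \<in> Rg" for r
      using g(3)[OF RgK[OF that]] by simp
  qed (rule that)
  have Sb: "S r \<in> sets borel" for r unfolding S_def Strips_def by auto
  have Slabb: "Slab r \<in> sets borel" "{x. \<alpha> r + h \<le> x \<bullet> e (fst r)} \<in> sets borel" for r
    unfolding Slab_def by measurable
  \<comment> \<open>Three kinds of bad points: outside the boxes, not covered by the strips of the
    slab, or inside some trench.\<close>
  define B1 where "B1 = \<Omega> - \<Union>\<K>"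
  define B2 where "B2 = (\<Union>r\<in>Rg. cball 0 R \<inter> Slab r - S r)"
  define B3 where "B3 = (\<Union>r\<in>Rg. cball 0 R \<inter> {x. \<alpha> r + h \<le> x \<bullet> e (fst r)} \<inter> S r)"
  have \<Omega>l: "\<Omega> \<in> lmeasurable" using \<Omega> lmeasurable_open by blast
  have B1: "B1 \<in> lmeasurable"
  proof -
    have "\<Union>\<K> \<in> sets borel" using \<K>(1) compK by (intro sets.finite_Union) (auto simp: borel_compact)
    then show ?thesis unfolding B1_def using \<Omega>l by (intro fmeasurable_Diff) auto
  qed
  have B2: "B2 \<in> lmeasurable" "measure lebesgue B2 \<le> real (card Rg) * \<eta>"
  proof -
    have "cball 0 R \<inter> Slab r - S r \<in> lmeasurable" for r
      using Slabb Sb by (intro fmeasurable_Diff fmeasurable_Int_fmeasurable) auto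
    then show "B2 \<in> lmeasurable" "measure lebesgue B2 \<le> real (card Rg) * \<eta>"
      unfolding B2_def by (auto intro!: measure_finite_UN_le_card Rg m1)
  qed
  have B3: "B3 \<in> lmeasurable" "measure lebesgue B3 \<le> real (card Rg) * \<eta>"
  proof -
    have "cball 0 R \<inter> {x. \<alpha> r + h \<le> x \<bullet> e (fst r)} \<inter> S r \<in> lmeasurable" for r
      using Slabb Sb by (intro fmeasurable_Int_fmeasurable) auto
    then show "B3 \<in> lmeasurable" "measure lebesgue B3 \<le> real (card Rg) * \<eta>"
      unfolding B3_def by (auto intro!: measure_finite_UN_le_card Rg m2)
  qed
  define B where "B = B1 \<union> B2 \<union> B3"
  have B: "B \<in> lmeasurable" unfolding B_def using B1 B2 B3 by (intro fmeasurable.Un)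
  have "measure lebesgue B \<le> measure lebesgue (B1 \<union> B2) + measure lebesgue B3"
    unfolding B_def using B1 B2 B3 by (intro measure_Un_le) (auto simp: fmeasurableD)
  moreover have "measure lebesgue (B1 \<union> B2) \<le> measure lebesgue B1 + measure lebesgue B2"
    using B1 B2 by (intro measure_Un_le) (auto simp: fmeasurableD)
  ultimately have mB: "measure lebesgue B \<le> 3 * \<delta>"
    using B2(2) B3(2) card_\<eta> \<K>(5) unfolding B1_def by linarith
  have "resistance \<Omega> u \<le> phi \<Omega> M + (C * \<delta> + \<delta>) * measure lebesgue \<Omega> + 3 * \<delta>"
  proof (rule resistance_le[OF \<Omega>(2,3) M u B mB Z])
    show "0 \<le> C * \<delta> + \<delta>" using C0 \<delta> by simp
    fix x assume "x \<in> \<Omega> - B - Z"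
    then have x: "x \<in> \<Omega>" "x \<notin> B1" "x \<notin> B2" "x \<notin> B3" "x \<notin> Z" by (auto simp: B_def)
    have xR: "norm x \<le> R" using R(2) x(1) by blast
    obtain K where K: "K \<in> \<K>" "x \<in> K" using x(1,2) by (auto simp: B1_def)
    define j where "j = \<lfloor>x \<bullet> e K / h\<rfloor>"
    have xe: "\<bar>x \<bullet> e K\<bar> \<le> R"
      using Cauchy_Schwarz_ineq2[of x "e K"] xR e1[OF K(1)] by simp
    have jle: "real_of_int j \<le> x \<bullet> e K / h" "x \<bullet> e K / h < real_of_int j + 1"
      unfolding j_def by linarith+
    have j: "real_of_int j * h \<le> x \<bullet> e K" "x \<bullet> e K < real_of_int j * h + h"
      using jle h(1) by (simp_all add: field_simps)
    have quot: "- (R / h) \<le> x \<bullet> e K / h" "x \<bullet> e K / h \<le> R / h"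
    proof -
      have "(- R) / h \<le> x \<bullet> e K / h" using xe h(1) by (intro divide_right_mono) auto
      then show "- (R / h) \<le> x \<bullet> e K / h" by simp
      show "x \<bullet> e K / h \<le> R / h" using xe h(1) by (intro divide_right_mono) auto
    qed
    have "R / h \<le> real_of_int J" unfolding J_def by (rule le_of_int_ceiling)
    then have "- real_of_int J - 1 < real_of_int j" "real_of_int j \<le> real_of_int J"
      using quot jle by linarith+
    then have "j \<in> {- J - 1..J}" by auto
    define r where "r = (K, j)"
    have r: "r \<in> Rg" using K \<open>j \<in> _\<close> by (simp add: r_def Rg_def)
    have xs: "x \<in> Slab r" using j by (simp add: Slab_def \<alpha>_def r_def)
    have xD: "x \<in> Dm r" using xs K by (simp add: Dm_def r_def)
    have xS: "x \<in> S r" using x(3) r xs xR by (auto simp: B2_def)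
    have xT: "x \<notin> (\<Union>r'\<in>Rg. {x. \<alpha> r' + h \<le> x \<bullet> e (fst r')} \<inter> S r')"
      using x(4) xR by (auto simp: B3_def)
    have *: "1 / (1 + (norm (grad u x))\<^sup>2) \<le> 1 / (1 + (g (fst r))\<^sup>2) + (\<rho> r)\<^sup>2"
      by (rule uZ[OF r xD xS[unfolded S_def Strips_def] xT[unfolded S_def Strips_def] x(5)])
    have "(\<rho> r)\<^sup>2 \<le> \<rho> r * 1"
      unfolding power2_eq_square using \<rho>(1)[OF r] by (intro mult_left_mono) auto
    then have \<rho>2: "(\<rho> r)\<^sup>2 \<le> \<delta>" using \<rho>(2)[OF r] \<eta>\<delta> by linarith
    have "dist (x0 K) x < \<delta>" using x0(2)[OF K(1)] K(2) by auto
    then have dd: "infdist x (frontier \<Omega>) \<le> D K" "D K \<le> infdist x (frontier \<Omega>) + 2 * \<delta>"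
      using infdist_triangle_abs[of x "frontier \<Omega>" "x0 K"] by (auto simp: D_def dist_commute)
    have "optimal_density (M - \<delta>) (D K) \<le>
        optimal_density M (infdist x (frontier \<Omega>)) + 2 * (2 * M + 2 * R) / M\<^sup>2 * \<delta>"
      by (rule optimal_density_perturb[OF M infdist_nonneg dd dR[OF x(1)] \<delta>(1,2)])
    then show "1 / (1 + (norm (grad u x))\<^sup>2) \<le> optimal_density M (infdist x (frontier \<Omega>)) + (C * \<delta> + \<delta>)"
      using * \<rho>2 g(4)[OF K(1)] unfolding C_def r_def fst_conv by linarith
  qed
  also have "\<dots> = phi \<Omega> M + \<delta> * E" by (simp add: E_def A_def algebra_simps)
  also have "\<dots> \<le> phi \<Omega> M + \<epsilon>" using \<delta> by simp
  finally show ?thesis using u by blast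
qed

theorem theorem1:
  fixes \<Omega> :: "(real^2) set" and M :: real
  assumes "convex \<Omega>" and "open \<Omega>" and "bounded \<Omega>" and "M > 0"
  shows "(INF u\<in>admissible \<Omega> M. resistance \<Omega> u) = phi \<Omega> M"
proof (rule antisym)
  have bdd: "bdd_below (resistance \<Omega> ` admissible \<Omega> M)"
    using phi_le_resistance[OF assms(2-4)] by (intro bdd_belowI2)
  show "(INF u\<in>admissible \<Omega> M. resistance \<Omega> u) \<le> phi \<Omega> M"
  proof (rule field_le_epsilon)
    fix \<epsilon> :: real assume "0 < \<epsilon>"
    then obtain u where "u \<in> admissible \<Omega> M" "resistance \<Omega> u \<le> phi \<Omega> M + \<epsilon>"
      using near_optimal_admissible[OF assms] by blast
    then show "(INF u\<in>admissible \<Omega> M. resistance \<Omega> u) \<le> phi \<Omega> M + \<epsilon>"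
      using bdd by (intro cINF_lower2)
  qed
  \<comment> \<open>The greatest lower bound property of \<open>INF\<close> over the reals needs a
    nonempty family; near-optimal functions provide one.\<close>
  have "admissible \<Omega> M \<noteq> {}" using near_optimal_admissible[OF assms, of 1] by auto
  then show "phi \<Omega> M \<le> (INF u\<in>admissible \<Omega> M. resistance \<Omega> u)"
    by (intro cINF_greatest phi_le_resistance assms)
qed

end
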